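(* There is a universal constant $C>0$ such that the following holds. Let $\ell,D_{\mathcal Y},\Delta>0$ and $f\in\mathcal F(\ell,D_{\mathcal Y},\Delta)$. For any $\epsilon>0$, the algorithm Tracked-FOAM, initialized at $z^0=\mathbf 0$, returns an $\epsilon$-OS point using at most $$C\left(\frac{\ell\Delta}{\epsilon^2}+1\right)\max\left\{1,\frac{\ell D_{\mathcal Y}}{\epsilon}\right\}$$ first-order saddle-oracle calls.
   Context: All norms are Euclidean; $\operatorname{proj}$ is Euclidean projection (projections onto $\mathcal X$, $\mathcal Y$ are free of oracle cost). Function class. $\mathcal F(\ell,D_{\mathcal Y},\Delta)$ is the class of all $f:\mathcal X\times\mathcal Y\to\mathbb R$, over all $m,n\in\mathbb N$ and nonempty closed convex $\mathcal X\subseteq\mathbb R^m$, $\mathcal Y\subseteq\mathbb R^n$ with $(\mathbf 0,\mathbf 0)\in\mathcal X\times\mathcal Y$, $\operatorname{diam}(\mathcal Y)\le D_{\mathcal Y}$, such that (i) $f$ is jointly $\ell$-smooth ($\nabla f$ is $\ell$-Lipschitz on $\mathcal X\times\mathcal Y$); (ii) $f(x;\cdot)$ is concave on $\mathcal Y$ for each $x\in\mathcal X$; (iii) $\Phi(\mathbf 0)-\inf_{\mathcal X}\Phi\le\Delta$, where $\Phi(x):=\max_{y\in\mathcal Y}f(x;y)+\iota_{\mathcal X}(x)$ ($\iota_{\mathcal X}=0$ on $\mathcal X$, $+\infty$ outside). A point $x\in\mathcal X$ is $\epsilon$-OS if $\|\nabla\Phi_{1/(2\ell)}(x)\|\le\epsilon$,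 where $\Phi_{1/(2\ell)}(x):=\min_{z\in\mathbb R^m}\{\Phi(z)+\ell\|x-z\|^2\}$. A first-order saddle-oracle call at $(x,y)\in\mathcal X\times\mathcal Y$ returns $(f(x;y),\nabla_xf(x;y),\nabla_yf(x;y))$. Relative-prox procedure at $(z,r_y)$ ($z\in\mathcal X$, $0<r_y\le\ell/8$) with input $(\omega_g,y_g)\in\mathbb R^m\times\mathbb R^n$. Let $\widehat F_z(x;y):=f(x;y)+\ell\|x-z\|^2-\frac{\ell}{2}\|x\|^2$, $\gamma:=8/\ell$, $\mathcal C':=\gamma^{-1/2}(\mathcal X\times\mathcal Y)$, and for $u=\gamma^{-1/2}(x,y)\in\mathcal C'$, $$A_g(u):=\sqrt\gamma\begin{pmatrix}\nabla_x\widehat F_z(x;y)+\frac{\ell}{2}(x-\ell^{-1}\omega_g)\\-\nabla_y\widehat F_z(x;y)+r_yy+\gamma^{-1}(y-y_g)\end{pmatrix}.$$ Set $u^{-1}=\gamma^{-1/2}(-\ell^{-1}\omega_g,y_g)$, $u^0=\operatorname{proj}_{\mathcal C'}(u^{-1})$, $\eta=32^{-2}$. For $s=1,2,\dots$ set $u^s=\operatorname{proj}_{\mathcal C'}(u^{s-1}-\eta A_g(u^{s-1}))$ and $b^s=\eta^{-1}(u^{s-1}-u^s)-A_g(u^{s-1})$, stopping at the first $s\ge1$ with $\|A_g(u^s)+b^s\|\le\|u^s-u^{-1}\|$. Output $(x_f,y_f^+)=\sqrt\gamma\,u^s$, and, with $(b_x,b_y)=\gamma^{-1/2}b^s$, $\omega_f^+=\nabla_x\widehat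 F_z(x_f;y_f^+)+b_x$, $w_f^+=-\nabla_y\widehat F_z(x_f;y_f^+)+b_y$. One FOAM step at $(z,r_y)$. A state is $S=(\omega,y,\omega_f,y_f)\in\mathbb R^m\times\mathbb R^n\times\mathbb R^m\times\mathbb R^n$. With $\alpha=\sqrt{8r_y/\ell}$, $\eta_\omega=\ell/2$, $\eta_y=4/(\alpha\ell)$: set $(\omega_g,y_g)=\alpha(\omega,y)+(1-\alpha)(\omega_f,y_f)$; compute $(x_f,y_f^+,\omega_f^+,w_f^+)$ by the relative-prox procedure at $(z,r_y)$ with input $(\omega_g,y_g)$; set $\omega^+=\omega+\eta_\omega\ell^{-1}(\omega_f^+-\omega)-\eta_\omega(x_f+\ell^{-1}\omega_f^+)$ and $y^+=y+\eta_yr_y(y_f^+-y)-\eta_y(w_f^++r_yy_f^+)$; return $(\omega^+,y^+,\omega_f^+,y_f^+)$. For $\rho\in(0,1)$, $\mathrm{FOAM}_{z,r_y}(S;\rho)$ is the state obtained from $S$ after $\lceil\frac{2}{\alpha}\log\frac1\rho\rceil$ such steps. Algorithm Tracked-FOAM (inputs $f$, $\ell,D_{\mathcal Y},\Delta,\epsilon$, $z^0=\mathbf 0$). 1. Set $r_{y,\epsilon}=\min\{\ell/8,\ \epsilon^2/(8\ell D_{\mathcal Y}^2)\}$. 2. Initialization: let $r_y^j:=4^{-j}\ell/8$ and $J:=\min\{j\ge0:r_y^j\le r_{y,\epsilon}\}$. Run the relative-prox procedure at $(\mathbf 0,\ell/8)$ with input $(\mathbf 0,\mathbf 0)$, get $(x_f,y_f,\omega_f,w_f)$,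 set $\widehat S^0=(\omega_f,y_f,\omega_f,y_f)$. For $j=1,\dots,J$ set $\widehat S^j=\mathrm{FOAM}_{\mathbf 0,r_y^j}(\widehat S^{j-1};1/8)$. Put $r_y:=r_y^J$, $S^0:=\widehat S^J$. 3. Set $B^0=15(\Delta+r_yD_{\mathcal Y}^2)$, $T=\lceil4000(\ell\Delta/\epsilon^2+1)\rceil$. 4. For $t=0,\dots,T-1$, with $S^t=(\omega^t,y^t,\omega_f^t,y_f^t)$: set $z^{t+1}=\operatorname{proj}_{\mathcal X}(-\omega_f^t/\ell)$, $d^t=z^{t+1}-z^t$, $Q^t=\ell\|d^t\|^2+B^t$; $S^{t+1}=\mathrm{FOAM}_{z^{t+1},r_y}\bigl((\omega^t-2\ell d^t,y^t,\omega_f^t-2\ell d^t,y_f^t);1/400\bigr)$; $B^{t+1}=\frac1{400}(2B^t+24\ell\|d^t\|^2)$. 5. Return $z^{t^\star}$, where $t^\star$ is the smallest minimizer of $Q^t$ over $0\le t<T$. *)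

theory Defs
  imports "HOL-Analysis.Analysis"
begin

subsection \<open>The Euclidean spaces $\mathbb R^n$ inside one type\<close>

text \<open>
  The constant of the theorem must not depend on the dimensions, so the quantifiers over the
  dimensions have to stay inside the formula. We therefore realise all the spaces
  $\mathbb R^n$ as subspaces \<open>Rn n\<close> of the finitely supported real sequences with the Euclidean
  inner product. (The library's norm on finitely supported maps is the $\ell^1$ norm.)
\<close>

typedef fsvec = "{v :: nat \<Rightarrow> real. finite {i. v i \<noteq> 0}}"
  morphisms coord Abs_fsvec
  by (rule exI[of _ "\<lambda>_. 0"]) simp

setup_lifting type_definition_fsvec

lemma finite_support [simp]: "finite {i. coord v i \<noteq> 0}"
  using coord[of v] by simp

lemma fsvec_eqI: "(\<And>i. coord v i = coord w i) \<Longrightarrow> v = w"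
  by (simp add: coord_inject[symmetric] fun_eq_iff)

instantiation fsvec :: real_vector
begin

lift_definition zero_fsvec :: fsvec is "\<lambda>_. 0"
  by simp

lift_definition plus_fsvec :: "fsvec \<Rightarrow> fsvec \<Rightarrow> fsvec" is "\<lambda>v w i. v i + w i"
  subgoal for v w by (rule finite_subset[of _ "{i. v i \<noteq> 0} \<union> {i. w i \<noteq> 0}"]) auto
  done

lift_definition minus_fsvec :: "fsvec \<Rightarrow> fsvec \<Rightarrow> fsvec" is "\<lambda>v w i. v i - w i"
  subgoal for v w by (rule finite_subset[of _ "{i. v i \<noteq> 0} \<union> {i. w i \<noteq> 0}"]) auto
  done

lift_definition uminus_fsvec :: "fsvec \<Rightarrow> fsvec" is "\<lambda>v i. - v i"
  by simp

lift_definition scaleR_fsvec :: "real \<Rightarrow> fsvec \<Rightarrow> fsvec" is "\<lambda>c v i. c * v i"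
  by (rule finite_subset[rotated]) auto

instance
  by standard (transfer; simp add: fun_eq_iff algebra_simps)+

end

lemmas coord_simps [simp] =
  zero_fsvec.rep_eq plus_fsvec.rep_eq minus_fsvec.rep_eq uminus_fsvec.rep_eq scaleR_fsvec.rep_eq

instantiation fsvec :: real_inner
begin

definition inner_fsvec :: "fsvec \<Rightarrow> fsvec \<Rightarrow> real" where
  "inner_fsvec v w = (\<Sum>i | coord v i \<noteq> 0. coord v i * coord w i)"

definition norm_fsvec :: "fsvec \<Rightarrow> real" where
  "norm_fsvec v = sqrt (inner v v)"

definition dist_fsvec :: "fsvec \<Rightarrow> fsvec \<Rightarrow> real" where
  "dist_fsvec v w = norm (v - w)"

definition sgn_fsvec :: "fsvec \<Rightarrow> fsvec" where
  "sgn_fsvec v = v /\<^sub>R norm v"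

definition uniformity_fsvec :: "(fsvec \<times> fsvec) filter" where
  "uniformity_fsvec = (INF e\<in>{0<..}. principal {(v, w). dist v w < e})"

definition open_fsvec :: "fsvec set \<Rightarrow> bool" where
  "open_fsvec U \<longleftrightarrow> (\<forall>v\<in>U. eventually (\<lambda>(v', w). v' = v \<longrightarrow> w \<in> U) uniformity)"

lemma inner_fsvec_superset:
  assumes "finite A" "{i. coord v i \<noteq> 0} \<subseteq> A"
  shows "inner v w = (\<Sum>i\<in>A. coord v i * coord w i)"
  unfolding inner_fsvec_def using assms by (intro sum.mono_neutral_left) auto

instance
proof
  fix v w x :: fsvec and r :: real
  define A where "A = {i. coord v i \<noteq> 0} \<union> {i. coord w i \<noteq> 0} \<union> {i. coord x i \<noteq> 0}"
  have A: "finite A" by (simp add: A_def)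
  have eq: "inner u u' = (\<Sum>i\<in>A. coord u i * coord u' i)" if "{i. coord u i \<noteq> 0} \<subseteq> A" for u u'
    using inner_fsvec_superset[OF A that] .
  show "dist v w = norm (v - w)" by (rule dist_fsvec_def)
  show "sgn v = v /\<^sub>R norm v" by (rule sgn_fsvec_def)
  show "inner v w = inner w v"
    by (subst (1 2) eq) (auto simp: A_def mult.commute)
  show "inner (v + w) x = inner v x + inner w x"
    by (subst (1 2 3) eq) (auto simp: A_def distrib_right sum.distrib)
  show "inner (r *\<^sub>R v) w = r * inner v w"
    by (subst (1 2) eq) (auto simp: A_def sum_distrib_left mult.assoc)
  show "0 \<le> inner v v"
    unfolding inner_fsvec_def by (intro sum_nonneg) simp
  show "inner v v = 0 \<longleftrightarrow> v = 0"
  proof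
    assume "inner v v = 0"
    then have "\<forall>i\<in>{i. coord v i \<noteq> 0}. coord v i * coord v i = 0"
      unfolding inner_fsvec_def by (subst (asm) sum_nonneg_eq_0_iff) auto
    then show "v = 0" by (intro fsvec_eqI) auto
  qed (simp add: inner_fsvec_def)
  show "norm v = sqrt (inner v v)" by (rule norm_fsvec_def)
qed (simp_all add: uniformity_fsvec_def open_fsvec_def)

end

definition Rn :: "nat \<Rightarrow> fsvec set" where
  "Rn n = {v. \<forall>i\<ge>n. coord v i = 0}"


subsection \<open>The function class and the optimality notion\<close>

text \<open>
  \<open>E\<close>, \<open>E'\<close> are the ambient spaces of \<open>X\<close>, \<open>Y\<close>. As \<open>f\<close> lives on \<open>X \<times> Y\<close> only, its gradient
  field \<open>g\<close> is the derivative within \<open>X \<times> Y\<close>. It is carried along as a datum, because \<open>f\<close>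
  does not determine it when \<open>X \<times> Y\<close> has empty interior in \<open>E \<times> E'\<close>.
\<close>

definition is_gradient_on ::
  "'a::real_inner set \<Rightarrow> 'a set \<Rightarrow> ('a \<Rightarrow> real) \<Rightarrow> ('a \<Rightarrow> 'a) \<Rightarrow> bool" where
  "is_gradient_on E S f g \<longleftrightarrow>
     (\<forall>p\<in>S. g p \<in> E \<and> (f has_derivative (\<lambda>h. g p \<bullet> h)) (at p within S))"

definition primal_fun :: "'a set \<Rightarrow> 'b set \<Rightarrow> ('a \<times> 'b \<Rightarrow> real) \<Rightarrow> 'a \<Rightarrow> ereal" where
  "primal_fun X Y f x = (SUP y\<in>Y. ereal (f (x, y))) + (if x \<in> X then 0 else \<infinity>)"

definition saddle_class ::
  "'a::real_inner set \<Rightarrow> 'b::real_inner set \<Rightarrow> real \<Rightarrow> real \<Rightarrow> real \<Rightarrow>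
   'a set \<Rightarrow> 'b set \<Rightarrow> ('a \<times> 'b \<Rightarrow> real) \<Rightarrow> ('a \<times> 'b \<Rightarrow> 'a \<times> 'b) \<Rightarrow> bool" where
  "saddle_class E E' l D \<Delta> X Y f g \<longleftrightarrow>
     X \<subseteq> E \<and> closed X \<and> convex X \<and> 0 \<in> X \<and>
     Y \<subseteq> E' \<and> closed Y \<and> convex Y \<and> 0 \<in> Y \<and>
     bounded Y \<and> diameter Y \<le> D \<and>
     is_gradient_on (E \<times> E') (X \<times> Y) f g \<and> l-lipschitz_on (X \<times> Y) g \<and>
     (\<forall>x\<in>X. concave_on Y (\<lambda>y. f (x, y))) \<and>
     primal_fun X Y f 0 - (INF x\<in>X. primal_fun X Y f x) \<le> ereal \<Delta>"

text \<open>
  The envelope $\Phi_{1/(2\ell)}$. Minima and maxima are written as infima and suprema in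
  \<^typ>\<open>ereal\<close>; for the class above they are attained and the envelope is finite.
\<close>

definition moreau_env :: "'a::real_inner set \<Rightarrow> real \<Rightarrow> ('a \<Rightarrow> ereal) \<Rightarrow> 'a \<Rightarrow> real" where
  "moreau_env E l \<Phi> x = real_of_ereal (INF z\<in>E. \<Phi> z + ereal (l * (norm (x - z))\<^sup>2))"

definition eps_OS ::
  "'a::real_inner set \<Rightarrow> real \<Rightarrow> 'a set \<Rightarrow> 'b set \<Rightarrow> ('a \<times> 'b \<Rightarrow> real) \<Rightarrow> real \<Rightarrow> 'a \<Rightarrow> bool" where
  "eps_OS E l X Y f \<epsilon> x \<longleftrightarrow>
     x \<in> X \<and>
     (\<exists>G\<in>E. (moreau_env E l (primal_fun X Y f) has_derivative (\<lambda>h. G \<bullet> h)) (at x within E) \<and>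
            norm G \<le> \<epsilon>)"


subsection \<open>Computations that count oracle calls\<close>

text \<open>
  \<open>Some (r, k)\<close>: the computation terminates with result \<open>r\<close> after \<open>k\<close> oracle calls; \<open>None\<close>: it
  does not terminate, or it calls the oracle outside its domain.
\<close>

type_synonym 'r run = "('r \<times> nat) option"

definition run_return :: "'r \<Rightarrow> 'r run" where
  "run_return r = Some (r, 0)"

definition run_bind :: "'r run \<Rightarrow> ('r \<Rightarrow> 's run) \<Rightarrow> 's run" (infixl "\<bind>\<^sub>r" 54) where
  "m \<bind>\<^sub>r k = Option.bind m (\<lambda>(r, i). Option.bind (k r) (\<lambda>(s, j). Some (s, i + j)))"

lemma run_bind_mono [partial_function_mono]:
  assumes "mono_option B" and "\<And>r. mono_option (\<lambda>F. K r F)"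
  shows "mono_option (\<lambda>F. B F \<bind>\<^sub>r (\<lambda>r. K r F))"
  unfolding run_bind_def case_prod_beta
  by (intro bind_mono assms option.const_mono)

primrec run_iter :: "nat \<Rightarrow> ('s \<Rightarrow> 's run) \<Rightarrow> 's \<Rightarrow> 's run" where
  "run_iter 0 body s = run_return s"
| "run_iter (Suc k) body s = body s \<bind>\<^sub>r run_iter k body"

partial_function (option) run_until :: "('s \<Rightarrow> bool) \<Rightarrow> ('s \<Rightarrow> 's run) \<Rightarrow> 's \<Rightarrow> 's run" where
  "run_until stop body s =
     (if stop s then run_return s else body s \<bind>\<^sub>r (\<lambda>s'. run_until stop body s'))"

type_synonym ('a, 'b) fo_oracle = "'a \<times> 'b \<Rightarrow> (real \<times> 'a \<times> 'b) run"

definition saddle_oracle ::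
  "'a set \<Rightarrow> 'b set \<Rightarrow> ('a \<times> 'b \<Rightarrow> real) \<Rightarrow> ('a \<times> 'b \<Rightarrow> 'a \<times> 'b) \<Rightarrow> ('a, 'b) fo_oracle" where
  "saddle_oracle X Y f g p =
     (if p \<in> X \<times> Y then Some ((f p, fst (g p), snd (g p)), 1) else None)"


subsection \<open>The relative-prox procedure\<close>

text \<open>The library's \<^const>\<open>closest_point\<close> without its Heine-Borel sort constraint.\<close>

definition proj :: "'a::real_inner set \<Rightarrow> 'a \<Rightarrow> 'a" where
  "proj S a = (SOME x. x \<in> S \<and> (\<forall>y\<in>S. dist a x \<le> dist a y))"

text \<open>
  The gradient of $\widehat F_z(x;y)=f(x;y)+\ell\|x-z\|^2-\frac{\ell}{2}\|x\|^2$ with respect to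
  $x$, where \<open>gx\<close> is the oracle's answer $\nabla_x f(x;y)$. With respect to $y$ the gradient
  is $\nabla_y f(x;y)$.
\<close>

definition grad_x_Fhat :: "real \<Rightarrow> 'a::real_inner \<Rightarrow> 'a \<Rightarrow> 'a \<Rightarrow> 'a" where
  "grad_x_Fhat l z x gx = gx + (2 * l) *\<^sub>R (x - z) - l *\<^sub>R x"

text \<open>
  The operator $A_g$ at $u=\gamma^{-1/2}(x,y)$, given the oracle's answer at $(x,y)$.
\<close>

definition A_op ::
  "real \<Rightarrow> 'a::real_inner \<Rightarrow> real \<Rightarrow> 'a \<times> 'b::real_inner \<Rightarrow> 'a \<times> 'b \<Rightarrow> real \<times> 'a \<times> 'b \<Rightarrow> 'a \<times> 'b" where
  "A_op l z ry = (\<lambda>(\<omega>g, yg) u (_, gx, gy).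
     let \<gamma> = 8 / l; (x, y) = sqrt \<gamma> *\<^sub>R u
     in sqrt \<gamma> *\<^sub>R
          (grad_x_Fhat l z x gx + (l / 2) *\<^sub>R (x - (1 / l) *\<^sub>R \<omega>g),
           - gy + ry *\<^sub>R y + (1 / \<gamma>) *\<^sub>R (y - yg)))"

text \<open>
  The loop state is $(u^s, a, b^s)$ with \<open>a\<close> the oracle's answer at $\sqrt\gamma\,u^s$, so each
  point is queried only once: a run stopping at index $s$ makes $s+1$ calls.
\<close>

definition rel_prox ::
  "('a::real_inner, 'b::real_inner) fo_oracle \<Rightarrow> 'a set \<Rightarrow> 'b set \<Rightarrow> real \<Rightarrow> 'a \<Rightarrow> real \<Rightarrow> 'a \<times> 'b
   \<Rightarrow> ('a \<times> 'b \<times> 'a \<times> 'b) run" where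
  "rel_prox orc X Y l z ry inp =
     (let \<gamma> = 8 / l; \<eta> = 1 / 32\<^sup>2;
          C' = (\<lambda>p. (1 / sqrt \<gamma>) *\<^sub>R p) ` (X \<times> Y);
          A = A_op l z ry inp;
          u_init = (1 / sqrt \<gamma>) *\<^sub>R (- (1 / l) *\<^sub>R fst inp, snd inp);
          u0 = proj C' u_init;
          step = (\<lambda>(u, a, b).
            let u' = proj C' (u - \<eta> *\<^sub>R A u a);
                b' = (1 / \<eta>) *\<^sub>R (u - u') - A u a
            in orc (sqrt \<gamma> *\<^sub>R u') \<bind>\<^sub>r (\<lambda>a'. run_return (u', a', b')));
          stop = (\<lambda>(u, a, b). norm (A u a + b) \<le> norm (u - u_init))
      in orc (sqrt \<gamma> *\<^sub>R u0) \<bind>\<^sub>r (\<lambda>a0. step (u0, a0, 0)) \<bind>\<^sub>r run_until stop step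
         \<bind>\<^sub>r (\<lambda>(u, (_, gx, gy), b).
            let (xf, yf) = sqrt \<gamma> *\<^sub>R u; (bx, by) = (1 / sqrt \<gamma>) *\<^sub>R b
            in run_return (xf, yf, grad_x_Fhat l z xf gx + bx, - gy + by)))"


subsection \<open>FOAM and Tracked-FOAM\<close>

type_synonym ('a, 'b) foam_state = "'a \<times> 'b \<times> 'a \<times> 'b"

definition foam_step ::
  "('a::real_inner, 'b::real_inner) fo_oracle \<Rightarrow> 'a set \<Rightarrow> 'b set \<Rightarrow> real \<Rightarrow> 'a \<Rightarrow> real
   \<Rightarrow> ('a, 'b) foam_state \<Rightarrow> ('a, 'b) foam_state run" where
  "foam_step orc X Y l z ry = (\<lambda>(\<omega>, y, \<omega>f, yf).
     let \<alpha> = sqrt (8 * ry / l); \<eta>\<omega> = l / 2; \<eta>y = 4 / (\<alpha> * l);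
         \<omega>g = \<alpha> *\<^sub>R \<omega> + (1 - \<alpha>) *\<^sub>R \<omega>f;
         yg = \<alpha> *\<^sub>R y + (1 - \<alpha>) *\<^sub>R yf
     in rel_prox orc X Y l z ry (\<omega>g, yg) \<bind>\<^sub>r (\<lambda>(xf, yf', \<omega>f', wf').
          run_return
            (\<omega> + (\<eta>\<omega> * (1 / l)) *\<^sub>R (\<omega>f' - \<omega>) - \<eta>\<omega> *\<^sub>R (xf + (1 / l) *\<^sub>R \<omega>f'),
             y + (\<eta>y * ry) *\<^sub>R (yf' - y) - \<eta>y *\<^sub>R (wf' + ry *\<^sub>R yf'),
             \<omega>f', yf')))"

definition foam ::
  "('a::real_inner, 'b::real_inner) fo_oracle \<Rightarrow> 'a set \<Rightarrow> 'b set \<Rightarrow> real \<Rightarrow> 'a \<Rightarrow> real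
   \<Rightarrow> ('a, 'b) foam_state \<Rightarrow> real \<Rightarrow> ('a, 'b) foam_state run" where
  "foam orc X Y l z ry S \<rho> =
     run_iter (nat \<lceil>2 / sqrt (8 * ry / l) * ln (1 / \<rho>)\<rceil>) (foam_step orc X Y l z ry) S"

definition ry_level :: "real \<Rightarrow> nat \<Rightarrow> real" where
  "ry_level l j = (1 / 4) ^ j * (l / 8)"

primrec tf_init ::
  "('a::real_inner, 'b::real_inner) fo_oracle \<Rightarrow> 'a set \<Rightarrow> 'b set \<Rightarrow> real \<Rightarrow> nat
   \<Rightarrow> ('a, 'b) foam_state run" where
  "tf_init orc X Y l 0 =
     rel_prox orc X Y l 0 (l / 8) (0, 0) \<bind>\<^sub>r (\<lambda>(xf, yf, \<omega>f, wf). run_return (\<omega>f, yf, \<omega>f, yf))"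
| "tf_init orc X Y l (Suc j) =
     tf_init orc X Y l j \<bind>\<^sub>r (\<lambda>S. foam orc X Y l 0 (ry_level l (Suc j)) S (1 / 8))"

text \<open>
  One outer iteration. Besides $(z^t, S^t, B^t)$ the loop carries the list of the pairs
  $(z^i, Q^i)$, $i<t$.
\<close>

definition tf_step ::
  "('a::real_inner, 'b::real_inner) fo_oracle \<Rightarrow> 'a set \<Rightarrow> 'b set \<Rightarrow> real \<Rightarrow> real
   \<Rightarrow> 'a \<times> ('a, 'b) foam_state \<times> real \<times> ('a \<times> real) list
   \<Rightarrow> ('a \<times> ('a, 'b) foam_state \<times> real \<times> ('a \<times> real) list) run" where
  "tf_step orc X Y l ry = (\<lambda>(z, (\<omega>, y, \<omega>f, yf), B, hist).
     let z' = proj X (- (1 / l) *\<^sub>R \<omega>f);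
         d = z' - z;
         Q = l * (norm d)\<^sup>2 + B;
         B' = (1 / 400) * (2 * B + 24 * l * (norm d)\<^sup>2)
     in foam orc X Y l z' ry (\<omega> - (2 * l) *\<^sub>R d, y, \<omega>f - (2 * l) *\<^sub>R d, yf) (1 / 400)
        \<bind>\<^sub>r (\<lambda>S'. run_return (z', S', B', hist @ [(z, Q)])))"

definition tracked_foam ::
  "('a::real_inner, 'b::real_inner) fo_oracle \<Rightarrow> 'a set \<Rightarrow> 'b set \<Rightarrow> real \<Rightarrow> real \<Rightarrow> real \<Rightarrow> real
   \<Rightarrow> 'a run" where
  "tracked_foam orc X Y l D \<Delta> \<epsilon> =
     (let ry_eps = min (l / 8) (\<epsilon>\<^sup>2 / (8 * l * D\<^sup>2));
          J = (LEAST j. ry_level l j \<le> ry_eps);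
          ry = ry_level l J;
          B0 = 15 * (\<Delta> + ry * D\<^sup>2);
          T = nat \<lceil>4000 * (l * \<Delta> / \<epsilon>\<^sup>2 + 1)\<rceil>
      in tf_init orc X Y l J
         \<bind>\<^sub>r (\<lambda>S0. run_iter T (tf_step orc X Y l ry) (0, S0, B0, []))
         \<bind>\<^sub>r (\<lambda>(_, _, _, hist).
              let Q = (\<lambda>t. snd (hist ! t));
                  t_star = (LEAST t. t < T \<and> (\<forall>t'<T. Q t \<le> Q t'))
              in run_return (fst (hist ! t_star))))"

end

theory Submission
  imports Defs
begin

text \<open>
  Replacing \<open>x\<close> by its dual variable \<open>\<omega>\<close> turns the regularised proximal saddle problem at \<open>z\<close> into the
  minimisation over \<open>(\<omega>, y)\<close> of \<open>|\<omega>|\<^sup>2/(2l) + r/2 |y|\<^sup>2 + sup\<^bsub>x\<^esub> (x \<bullet> \<omega> - Fhat z x y)\<close>. A FOAM step is an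
  accelerated inexact proximal point step for this strongly convex function, and its potential
  contracts by \<open>1 - \<alpha>/2\<close>. Each inexact step is a projected gradient iteration for an operator of
  condition number 20, so its relative accuracy is reached after a constant number of calls.

  Moving the centre by \<open>d\<close> at most doubles the potential \<open>e\<close> and adds \<open>24 l |d|\<^sup>2\<close>, and the FOAM run
  divides it by 400, so \<open>B\<close> dominates \<open>e\<close> throughout. The saddle value at the centre decreases by
  \<open>l |d|\<^sup>2/2 - 4e\<close> per outer iteration; hence the
  \<open>Q\<close> sum to \<open>O(\<Delta> + r D\<^sup>2)\<close>, and the smallest of them is \<open>O(\<epsilon>\<^sup>2/l)\<close>. It bounds the distance from the
  centre to the regularised proximal point, which in turn is within \<open>\<epsilon>/(4l)\<close> of the exact one.
\<close>

section \<open>Projections and monotone operators\<close>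

text \<open>The ambient inner product spaces need not be complete and have no compact balls, so
  existence cannot come from compactness. Minimisers arise as limits of minimising sequences, which
  strong convexity makes Cauchy, and saddle points arise from Banach's fixed point theorem, both
  inside complete sets. The dual function is never formed as a supremum: its values and subgradients
  enter through witnesses \<open>certified z x y \<omega> w\<close>, and each convexity argument
  compares two of them. The size of \<open>r\<close> balances two demands. Regularisation displaces
  the proximal point by at most D * sqrt (r / (2 l)), which has to be O(\<epsilon> / l), so r is of
  order \<epsilon>^2 / (l D^2). On the other hand the dual function has modulus r in y while a
  proximal step has length 8 / l, so acceleration costs of order 1 / \<alpha> = sqrt (l / (8 r))
  steps. For this r that is of order l D / \<epsilon>, the last factor of the call bound; the cap r
  \<le> l / 8 is the source of the 1 in its maximum.\<close>

lemma strongly_midconvex_has_minimizer: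
  fixes h :: "'a::real_inner \<Rightarrow> real"
  assumes S: "complete S" "S \<noteq> {}" and c: "c > 0"
    and lower: "\<And>x. x \<in> S \<Longrightarrow> m \<le> h x"
    and mid: "\<And>x y. x \<in> S \<Longrightarrow> y \<in> S \<Longrightarrow>
      \<exists>w\<in>S. h w \<le> (h x + h y) / 2 - c * (norm (x - y))\<^sup>2"
    and lsc: "\<And>s x e. (\<And>n. s n \<in> S) \<Longrightarrow> x \<in> S \<Longrightarrow> s \<longlonglongrightarrow> x \<Longrightarrow>
      (\<lambda>n. h (s n)) \<longlonglongrightarrow> e \<Longrightarrow> h x \<le> e"
  shows "\<exists>x\<in>S. \<forall>y\<in>S. h x \<le> h y"
proof -
  define I where "I = Inf (h ` S)"
  have bdd: "bdd_below (h ` S)" using lower by (auto simp: bdd_below_def)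
  have I_le: "I \<le> h x" if "x \<in> S" for x
    unfolding I_def using bdd that by (auto intro: cInf_lower)
  have "\<exists>x\<in>S. h x < I + 1 / real (Suc n)" for n
  proof -
    have "I < I + 1 / real (Suc n)" by simp
    then have "\<exists>r\<in>h ` S. r < I + 1 / real (Suc n)"
      using cInf_less_iff[OF _ bdd] S(2) unfolding I_def by blast
    then show ?thesis by blast
  qed
  then obtain s where s: "\<And>n. s n \<in> S" "\<And>n. h (s n) < I + 1 / real (Suc n)" by metis
  have hs: "(\<lambda>n. h (s n)) \<longlonglongrightarrow> I"
  proof (rule tendsto_sandwich[of "\<lambda>_. I" _ _ "\<lambda>n. I + 1 / real (Suc n)"])
    show "(\<lambda>n. I + 1 / real (Suc n)) \<longlonglongrightarrow> I"
      using tendsto_add[OF tendsto_const LIMSEQ_Suc[OF lim_1_over_n], of I] by simp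
  qed (use s I_le in \<open>auto intro!: always_eventually less_imp_le\<close>)
  have "Cauchy s"
  proof (rule metric_CauchyI)
    fix e :: real assume e: "e > 0"
    then have "c * e\<^sup>2 > 0" using c by simp
    then obtain N where N: "1 / real (Suc N) < c * e\<^sup>2"
      using nat_approx_posE by blast
    have "dist (s i) (s j) < e" if "i \<ge> N" "j \<ge> N" for i j
    proof -
      obtain w where w: "w \<in> S" "h w \<le> (h (s i) + h (s j)) / 2 - c * (norm (s i - s j))\<^sup>2"
        using mid[OF s(1) s(1)] by blast
      have "1 / real (Suc i) \<le> 1 / real (Suc N)" "1 / real (Suc j) \<le> 1 / real (Suc N)"
        using that by (auto intro!: divide_left_mono)
      then have "c * (norm (s i - s j))\<^sup>2 < c * e\<^sup>2"
        using w I_le[OF w(1)] s(2)[of i] s(2)[of j] N by argo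
      then have "(norm (s i - s j))\<^sup>2 < e\<^sup>2" using c by simp
      then show ?thesis unfolding dist_norm using e by (meson less_imp_le power2_less_imp_less)
    qed
    then show "\<exists>N. \<forall>i\<ge>N. \<forall>j\<ge>N. dist (s i) (s j) < e" by blast
  qed
  then obtain x where x: "x \<in> S" "s \<longlonglongrightarrow> x" using S(1) s(1) by (meson completeE)
  have "h x \<le> I" using lsc[OF s(1) x hs] .
  with I_le x(1) show ?thesis by (meson order_trans)
qed

context
  fixes S :: "'a::real_inner set"
  assumes S: "complete S" "convex S" "S \<noteq> {}"
begin

lemma proj_closest: "proj S a \<in> S \<and> (\<forall>y\<in>S. dist a (proj S a) \<le> dist a y)"
proof -
  have "\<exists>x\<in>S. \<forall>y\<in>S. (norm (a - x))\<^sup>2 \<le> (norm (a - y))\<^sup>2"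
  proof (rule strongly_midconvex_has_minimizer[OF S(1,3), of "1/4" 0])
    fix x y assume "x \<in> S" "y \<in> S"
    moreover have "(norm (a - ((1/2) *\<^sub>R x + (1/2) *\<^sub>R y)))\<^sup>2
        = ((norm (a - x))\<^sup>2 + (norm (a - y))\<^sup>2) / 2 - 1/4 * (norm (x - y))\<^sup>2"
      unfolding power2_norm_eq_inner by (simp add: inner_simps inner_commute field_simps)
    ultimately show "\<exists>w\<in>S. (norm (a - w))\<^sup>2
        \<le> ((norm (a - x))\<^sup>2 + (norm (a - y))\<^sup>2) / 2 - 1/4 * (norm (x - y))\<^sup>2"
      using S(2) by (intro bexI[of _ "(1/2) *\<^sub>R x + (1/2) *\<^sub>R y"]) (auto intro: convexD)
  next
    fix s x e
    assume "s \<longlonglongrightarrow> x" and lim: "(\<lambda>n. (norm (a - s n))\<^sup>2) \<longlonglongrightarrow> e"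
    then have "(\<lambda>n. (norm (a - s n))\<^sup>2) \<longlonglongrightarrow> (norm (a - x))\<^sup>2" by (intro tendsto_intros)
    with lim show "(norm (a - x))\<^sup>2 \<le> e" using LIMSEQ_unique by blast
  qed auto
  then have "\<exists>x. x \<in> S \<and> (\<forall>y\<in>S. dist a x \<le> dist a y)"
    by (auto simp: dist_norm power_mono_iff intro: power2_le_imp_le)
  then show ?thesis unfolding proj_def by (rule someI_ex)
qed

lemma proj_in: "proj S a \<in> S"
  using proj_closest by blast

lemma inner_proj_le_0:
  assumes "y \<in> S" shows "(a - proj S a) \<bullet> (y - proj S a) \<le> 0"
  using any_closest_point_dot[OF S(2) complete_imp_closed[OF S(1)] proj_in assms] proj_closest
  by blast

lemma proj_nonexpansive: "norm (proj S a - proj S b) \<le> norm (a - b)"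
proof -
  have "(norm (proj S a - proj S b))\<^sup>2 \<le> (a - b) \<bullet> (proj S a - proj S b)"
    using inner_proj_le_0[OF proj_in, of a b] inner_proj_le_0[OF proj_in, of b a]
    by (simp add: power2_norm_eq_inner inner_simps inner_commute algebra_simps)
  also have "\<dots> \<le> norm (a - b) * norm (proj S a - proj S b)" by (rule norm_cauchy_schwarz)
  finally show ?thesis by (cases "proj S a = proj S b") (auto simp: power2_eq_square)
qed

lemma proj_self: "a \<in> S \<Longrightarrow> proj S a = a"
  using proj_closest[of a] by force

lemma proj_dist_le:
  assumes "x \<in> S" shows "norm (proj S a - x) \<le> norm (a - x)"
  using proj_nonexpansive[of a x] proj_self[OF assms] by simp

end

lemma complete_Times:
  fixes S :: "'a::metric_space set" and T :: "'b::metric_space set"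
  assumes "complete S" "complete T"
  shows "complete (S \<times> T)"
  unfolding complete_def
proof (intro allI impI)
  fix s :: "nat \<Rightarrow> 'a \<times> 'b" assume s: "(\<forall>n. s n \<in> S \<times> T) \<and> Cauchy s"
  obtain a where a: "a \<in> S" "(\<lambda>n. fst (s n)) \<longlonglongrightarrow> a"
    using s completeE[OF assms(1), of "\<lambda>n. fst (s n)"] Cauchy_fst by (auto simp: mem_Times_iff)
  obtain b where b: "b \<in> T" "(\<lambda>n. snd (s n)) \<longlonglongrightarrow> b"
    using s completeE[OF assms(2), of "\<lambda>n. snd (s n)"] Cauchy_snd by (auto simp: mem_Times_iff)
  have "s \<longlonglongrightarrow> (a, b)" using tendsto_Pair[OF a(2) b(2)] by simp
  with a b show "\<exists>p\<in>S \<times> T. s \<longlonglongrightarrow> p" by blast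
qed

definition proj_step :: "'a::real_inner set \<Rightarrow> real \<Rightarrow> ('a \<Rightarrow> 'a) \<Rightarrow> 'a \<Rightarrow> 'a" where
  "proj_step S \<eta> A u = proj S (u - \<eta> *\<^sub>R A u)"

locale monotone_operator =
  fixes S :: "'a::real_inner set" and A :: "'a \<Rightarrow> 'a" and \<mu> L :: real
  assumes S: "complete S" "convex S" "S \<noteq> {}"
    and mono: "\<And>u v. u \<in> S \<Longrightarrow> v \<in> S \<Longrightarrow> \<mu> * (norm (u - v))\<^sup>2 \<le> (A u - A v) \<bullet> (u - v)"
    and lip: "\<And>u v. u \<in> S \<Longrightarrow> v \<in> S \<Longrightarrow> norm (A u - A v) \<le> L * norm (u - v)"
begin

text \<open>The projection is nonexpansive, so it suffices to bound the forward step. In its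
  expanded square, monotonicity controls the cross term and the Lipschitz bound the last
  one.\<close>

lemma proj_step_contraction:
  assumes "u \<in> S" "v \<in> S" "\<eta> \<ge> 0" "c \<ge> 0" "1 - 2 * \<eta> * \<mu> + \<eta>\<^sup>2 * L\<^sup>2 \<le> c\<^sup>2"
  shows "norm (proj_step S \<eta> A u - proj_step S \<eta> A v) \<le> c * norm (u - v)"
proof -
  have "norm (proj_step S \<eta> A u - proj_step S \<eta> A v) \<le> norm ((u - v) - \<eta> *\<^sub>R (A u - A v))"
    unfolding proj_step_def
    by (rule order_trans[OF proj_nonexpansive[OF S]]) (simp add: algebra_simps)
  also have "\<dots> \<le> c * norm (u - v)"
  proof (rule power2_le_imp_le)
    have "(norm ((u - v) - \<eta> *\<^sub>R (A u - A v)))\<^sup>2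
        = (norm (u - v))\<^sup>2 - 2 * \<eta> * ((A u - A v) \<bullet> (u - v)) + \<eta>\<^sup>2 * (norm (A u - A v))\<^sup>2"
      unfolding power2_norm_eq_inner
      by (simp add: inner_simps inner_commute algebra_simps power2_eq_square)
    also have "\<dots> \<le> (norm (u - v))\<^sup>2 - 2 * \<eta> * (\<mu> * (norm (u - v))\<^sup>2)
        + \<eta>\<^sup>2 * (L * norm (u - v))\<^sup>2"
      using assms mono lip by (intro add_mono diff_mono mult_left_mono power_mono) auto
    also have "\<dots> = (1 - 2 * \<eta> * \<mu> + \<eta>\<^sup>2 * L\<^sup>2) * (norm (u - v))\<^sup>2"
      by (simp add: algebra_simps power_mult_distrib)
    also have "\<dots> \<le> c\<^sup>2 * (norm (u - v))\<^sup>2" using assms by (intro mult_right_mono) auto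
    finally show "(norm ((u - v) - \<eta> *\<^sub>R (A u - A v)))\<^sup>2 \<le> (c * norm (u - v))\<^sup>2"
      by (simp add: power_mult_distrib)
  qed (use assms in auto)
  finally show ?thesis .
qed

lemma proj_step_in: "proj_step S \<eta> A u \<in> S"
  unfolding proj_step_def by (rule proj_in[OF S])

lemma proj_step_fixed_point:
  assumes "\<eta> \<ge> 0" "1 - 2 * \<eta> * \<mu> + \<eta>\<^sup>2 * L\<^sup>2 \<le> c\<^sup>2" "0 \<le> c" "c < 1"
  obtains u where "u \<in> S" "proj_step S \<eta> A u = u"
proof -
  have "\<exists>!u\<in>S. proj_step S \<eta> A u = u"
    by (rule Banach_fix[OF S(1,3) assms(3,4)])
      (auto simp: dist_norm proj_step_in intro!: proj_step_contraction assms)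
  then show thesis using that by blast
qed

text \<open>The projected forward step with a suitable step size is a contraction; the projection
  inequality at its fixed point, divided by the step size, is the claim.\<close>

lemma variational_inequality:
  assumes "0 < \<mu>" "\<mu> \<le> L"
  obtains u where "u \<in> S" "\<And>v. v \<in> S \<Longrightarrow> 0 \<le> A u \<bullet> (v - u)"
proof -
  \<comment> \<open>This step size minimises the contraction factor
    \<open>1 - 2 * \<eta> * \<mu> + \<eta>\<^sup>2 * L\<^sup>2\<close>.\<close>
  define \<eta> c where "\<eta> = \<mu> / L\<^sup>2" and "c = sqrt (1 - (\<mu> / L)\<^sup>2)"
  have L: "L > 0" and \<eta>: "\<eta> > 0" using assms by (auto simp: \<eta>_def)
  have le: "(\<mu> / L)\<^sup>2 \<le> 1" using assms by (simp add: power_le_one)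
  then have c2: "c\<^sup>2 = 1 - (\<mu> / L)\<^sup>2" by (simp add: c_def)
  have "1 - 2 * \<eta> * \<mu> + \<eta>\<^sup>2 * L\<^sup>2 = c\<^sup>2"
    using L unfolding c2 \<eta>_def by (simp add: power2_eq_square field_simps)
  moreover have "0 \<le> c" "c < 1" using le assms L by (auto simp: c_def)
  ultimately obtain u where u: "u \<in> S" "proj_step S \<eta> A u = u"
    using proj_step_fixed_point[of \<eta> c] \<eta> by auto
  have "0 \<le> A u \<bullet> (v - u)" if "v \<in> S" for v
    using inner_proj_le_0[OF S that, of "u - \<eta> *\<^sub>R A u"] u(2) \<eta>
    by (simp add: proj_step_def zero_le_mult_iff)
  with u(1) show thesis using that by blast
qed

end

text \<open>
  The budget makes the contraction factor \<open>4200\<close> times smaller than one, which beats the factor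
  \<open>2 (L + 1/\<eta>)\<close> with \<open>L = 20\<close> in the residual.
\<close>

definition prox_budget :: nat where
  "prox_budget = (LEAST n. sqrt (1023 / 1024) ^ n \<le> 1 / 4200)"

lemma prox_budget: "sqrt (1023 / 1024) ^ prox_budget \<le> 1 / 4200"
proof -
  have "\<exists>n. sqrt (1023 / 1024) ^ n \<le> 1 / 4200"
    using real_arch_pow_inv[of "1 / 4200" "sqrt (1023 / 1024)"] by (auto intro: less_imp_le)
  then show ?thesis unfolding prox_budget_def by (rule LeastI_ex)
qed

text \<open>Both sides are measured against the distance \<open>d\<close> from the start to the
  fixed point. Contraction makes the residual a fraction of \<open>d\<close>. The projection does
  not increase distances, so \<open>w\<close> is at least \<open>d\<close> away from the fixed point
  and hence almost \<open>d\<close> away from the last iterate. One iteration count therefore serves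
  every \<open>w\<close>.\<close>

lemma (in monotone_operator) relative_residual:
  assumes \<mu>: "\<mu> = 1" and L: "L = 20" and u_def: "\<And>s. u s = (proj_step S (1 / 1024) A ^^ s) (proj S w)"
  shows "norm (A (u (Suc prox_budget)) + (1024 *\<^sub>R (u prox_budget - u (Suc prox_budget)) - A (u prox_budget)))
    \<le> norm (u (Suc prox_budget) - w)"
proof -
  define c :: real where "c = sqrt (1023 / 1024)"
  define T where "T = proj_step S (1 / 1024) A"
  define N where "N = prox_budget"
  have c: "0 \<le> c" "c < 1" "c ^ N \<le> 1 / 4200" using prox_budget by (auto simp: c_def N_def)
  \<comment> \<open>The factor is 1 - 2/1024 + 400/1024^2, and 400 \<le> 1024.\<close>
  have c2: "1 - 2 * (1 / 1024) * \<mu> + (1 / 1024)\<^sup>2 * L\<^sup>2 \<le> c\<^sup>2"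
    by (simp add: c_def \<mu> L power2_eq_square)
  obtain us where us: "us \<in> S" "T us = us"
    unfolding T_def using proj_step_fixed_point[OF _ c2 c(1,2)] by auto
  have u0: "u 0 \<in> S" by (simp add: u_def proj_in[OF S])
  have uS: "u (Suc s) = T (u s)" for s by (simp add: u_def T_def)
  have u_in: "u s \<in> S" for s by (cases s) (auto simp: u0 uS T_def proj_step_in)
  define d where "d = norm (u 0 - us)"
  have dist: "norm (u s - us) \<le> c ^ s * d" for s
  proof (induction s)
    case (Suc s)
    have "norm (u (Suc s) - us) \<le> c * norm (u s - us)"
      using proj_step_contraction[OF u_in us(1) _ c(1) c2, of s] us(2) by (simp add: uS T_def)
    also have "\<dots> \<le> c * (c ^ s * d)" using Suc c by (intro mult_left_mono) auto
    finally show ?case by simp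
  qed (simp add: d_def)
  have d0: "d \<ge> 0" by (simp add: d_def)
  have small: "norm (u N - us) \<le> d / 4200" "norm (u (Suc N) - us) \<le> d / 4200"
  proof -
    show 1: "norm (u N - us) \<le> d / 4200"
      using dist[of N] mult_right_mono[OF c(3) d0] by simp
    have "c ^ Suc N \<le> c ^ N" using c by (intro power_decreasing) auto
    then have "c ^ Suc N * d \<le> d / 4200"
      using mult_right_mono[of "c ^ Suc N" "1 / 4200" d] d0 c by auto
    then show "norm (u (Suc N) - us) \<le> d / 4200" using dist[of "Suc N"] by linarith
  qed
  have step: "norm (u N - u (Suc N)) \<le> d / 2100"
    using norm_triangle_ineq4[of "u N - us" "u (Suc N) - us"] small by simp
  have "norm (A (u (Suc N)) + (1024 *\<^sub>R (u N - u (Suc N)) - A (u N)))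
      \<le> norm (A (u (Suc N)) - A (u N)) + norm (1024 *\<^sub>R (u N - u (Suc N)))"
    by (rule order_trans[OF eq_refl norm_triangle_ineq]) (simp add: algebra_simps)
  also have "\<dots> \<le> 20 * norm (u N - u (Suc N)) + 1024 * norm (u N - u (Suc N))"
    using lip[OF u_in u_in, of "Suc N" N] by (simp add: L norm_minus_commute)
  also have "\<dots> \<le> d - d / 4200" using step d0 by simp
  also have "\<dots> \<le> norm (w - us) - norm (u (Suc N) - us)"
    using proj_dist_le[OF S us(1), of w] small by (simp add: d_def u_def)
  also have "\<dots> \<le> norm (u (Suc N) - w)"
    using norm_triangle_ineq4[of "u (Suc N) - us" "u (Suc N) - w"]
    by (simp add: norm_minus_commute)
  finally show ?thesis by (simp add: N_def)
qed

section \<open>Termination and cost of loops\<close>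

lemma run_until_sequence:
  assumes body: "\<And>i. body (s i) = Some (s (Suc i), 1)" and stop: "stop (s n)"
  obtains k where "k \<le> n" "stop (s k)" "run_until stop body (s 0) = Some (s k, k)"
proof -
  define k where "k = (LEAST i. stop (s i))"
  have k: "stop (s k)" "k \<le> n" unfolding k_def using stop by (auto intro: LeastI Least_le)
  have below: "\<not> stop (s i)" if "i < k" for i using that not_less_Least unfolding k_def by blast
  \<comment> \<open>Induction on the number of iterations still to run, backwards from the first
    index that passes the test; it yields termination and the count together.\<close>
  have "run_until stop body (s (k - j)) = Some (s k, j)" if "j \<le> k" for j
    using that
  proof (induction j)
    case 0
    then show ?case using k by (subst run_until.simps) (simp add: run_return_def)
  next
    case (Suc j)
    have "run_until stop body (s (k - Suc j)) =
        body (s (k - Suc j)) \<bind>\<^sub>r (\<lambda>s'. run_until stop body s')"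
      using below[of "k - Suc j"] Suc by (subst run_until.simps) simp
    also have "\<dots> = Some (s k, Suc j)"
      using Suc by (simp add: body run_bind_def Suc_diff_Suc)
    finally show ?case .
  qed
  from this[of k] k show thesis using that by simp
qed

lemma run_iter_invariant:
  assumes step: "\<And>i s. P i s \<Longrightarrow> \<exists>s' k. body s = Some (s', k) \<and> k \<le> N \<and> P (Suc i) s'"
    and "P i s"
  shows "\<exists>s' k. run_iter n body s = Some (s', k) \<and> k \<le> n * N \<and> P (i + n) s'"
  using assms(2)
proof (induction n arbitrary: i s)
  case 0
  then show ?case by (auto simp: run_return_def)
next
  case (Suc n)
  obtain s1 k1 where 1: "body s = Some (s1, k1)" "k1 \<le> N" "P (Suc i) s1"
    using step[OF Suc.prems] by blast
  obtain s2 k2 where 2: "run_iter n body s1 = Some (s2, k2)" "k2 \<le> n * N" "P (Suc i + n) s2"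
    using Suc.IH[OF 1(3)] by blast
  show ?case using 1 2 by (auto simp: run_bind_def)
qed

section \<open>The smooth saddle problem and its dual certificates\<close>

text \<open>The diameter enters as a norm bound, which it implies because 0 lies in
  \<open>Y\<close>.\<close>

locale smooth_saddle =
  fixes X :: "'a::real_inner set" and Y :: "'b::real_inner set"
    and f :: "'a \<times> 'b \<Rightarrow> real" and g :: "'a \<times> 'b \<Rightarrow> 'a \<times> 'b" and l D :: real
  assumes l: "l > 0"
    and X: "complete X" "convex X" "0 \<in> X"
    and Y: "complete Y" "convex Y" "0 \<in> Y"
    and norm_Y: "\<And>y. y \<in> Y \<Longrightarrow> norm y \<le> D"
    and deriv: "\<And>p. p \<in> X \<times> Y \<Longrightarrow> (f has_derivative (\<lambda>h. g p \<bullet> h)) (at p within X \<times> Y)"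
    and lip: "l-lipschitz_on (X \<times> Y) g"
    and conc: "\<And>x. x \<in> X \<Longrightarrow> concave_on Y (\<lambda>y. f (x, y))"
begin

lemma norm2_Y: "y \<in> Y \<Longrightarrow> (norm y)\<^sup>2 \<le> D\<^sup>2"
  using norm_Y by (simp add: power_mono)

text \<open>Derivatives exist only within \<open>X \<times> Y\<close>, so the estimate is made along
  the segment, which convexity keeps inside. The mean value theorem takes the place of integrating
  the gradient.\<close>

lemma descent:
  assumes p: "p \<in> X \<times> Y" and q: "q \<in> X \<times> Y"
  shows "\<bar>f q - f p - g p \<bullet> (q - p)\<bar> \<le> l / 2 * (norm (q - p))\<^sup>2"
proof -
  define \<phi> where "\<phi> t = p + t *\<^sub>R (q - p)" for t :: real
  have conv: "convex (X \<times> Y)" using X Y by (simp add: convex_Times)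
  have \<phi>_in: "\<phi> t \<in> X \<times> Y" if "0 \<le> t" "t \<le> 1" for t
    using convexD_alt[OF conv p q that] by (simp add: \<phi>_def algebra_simps)
  have d\<phi>: "((\<lambda>t. f (\<phi> t)) has_derivative (\<lambda>s. g (\<phi> t) \<bullet> (s *\<^sub>R (q - p)))) (at t within {0..1})"
    if "0 \<le> t" "t \<le> 1" for t
  proof (rule has_derivative_in_compose2[OF deriv])
    show "(\<phi> has_derivative (\<lambda>s. s *\<^sub>R (q - p))) (at t within {0..1})"
      unfolding \<phi>_def by (auto intro!: derivative_eq_intros)
    show "\<phi> ` {0..1} \<subseteq> X \<times> Y" using \<phi>_in by (intro image_subsetI) auto
  qed (use that in auto)
  have bound: "\<bar>(g (\<phi> t) - g p) \<bullet> (q - p)\<bar> \<le> l * t * (norm (q - p))\<^sup>2" if "0 \<le> t" "t \<le> 1" for t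
  proof -
    have "\<bar>(g (\<phi> t) - g p) \<bullet> (q - p)\<bar> \<le> norm (g (\<phi> t) - g p) * norm (q - p)"
      by (rule Cauchy_Schwarz_ineq2)
    also have "\<dots> \<le> (l * norm (\<phi> t - p)) * norm (q - p)"
      using lipschitz_on_normD[OF lip \<phi>_in[OF that] p] by (intro mult_right_mono) auto
    finally show ?thesis using that by (simp add: \<phi>_def power2_eq_square)
  qed
  have aux: "\<sigma> * (f q - f p - g p \<bullet> (q - p)) \<le> l / 2 * (norm (q - p))\<^sup>2"
    if \<sigma>: "\<sigma> = 1 \<or> \<sigma> = -1" for \<sigma> :: real
  proof -
    \<comment> \<open>\<open>\<psi>\<close> is, up to a constant, the signed linearisation error at
      \<open>t\<close> minus its claimed bound; \<open>bound\<close> makes its derivative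
      nonpositive.\<close>
    define \<psi> where "\<psi> t = \<sigma> * (f (\<phi> t) - t * (g p \<bullet> (q - p))) - l / 2 * t\<^sup>2 * (norm (q - p))\<^sup>2" for t
    have "\<exists>t\<in>{0<..<1}. \<psi> 1 - \<psi> 0 = (\<lambda>s. \<sigma> * (g (\<phi> t) \<bullet> (s *\<^sub>R (q - p)) - s * (g p \<bullet> (q - p)))
        - l / 2 * (2 * t * s) * (norm (q - p))\<^sup>2) (1 - 0)"
      unfolding \<psi>_def
      by (rule mvt_simple) (auto intro!: derivative_eq_intros d\<phi> simp: power2_eq_square algebra_simps)
    then obtain t where t: "0 < t" "t < 1"
      "\<psi> 1 - \<psi> 0 = \<sigma> * ((g (\<phi> t) - g p) \<bullet> (q - p)) - l * t * (norm (q - p))\<^sup>2"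
      by (auto simp: inner_diff_left)
    have "\<psi> 1 \<le> \<psi> 0" using t bound[of t] \<sigma> by auto
    then show ?thesis by (simp add: \<psi>_def \<phi>_def algebra_simps)
  qed
  show ?thesis using aux[of 1] aux[of "-1"] by (intro abs_leI) auto
qed

abbreviation gx :: "'a \<Rightarrow> 'b \<Rightarrow> 'a" where "gx x y \<equiv> fst (g (x, y))"
abbreviation gy :: "'a \<Rightarrow> 'b \<Rightarrow> 'b" where "gy x y \<equiv> snd (g (x, y))"

lemma descent_x:
  assumes "x \<in> X" "x' \<in> X" "y \<in> Y"
  shows "\<bar>f (x', y) - f (x, y) - gx x y \<bullet> (x' - x)\<bar> \<le> l / 2 * (norm (x' - x))\<^sup>2"
  using descent[of "(x, y)" "(x', y)"] assms by (simp add: inner_prod_def norm_Pair)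

text \<open>Concavity along the segment meets the descent bound at a small step \<open>t\<close>;
  after division by \<open>t\<close> only the error \<open>t * K\<close> remains.\<close>

lemma concave_gradient:
  assumes x: "x \<in> X" and y: "y \<in> Y" and y': "y' \<in> Y"
  shows "f (x, y') \<le> f (x, y) + gy x y \<bullet> (y' - y)"
proof (rule field_le_epsilon)
  fix e :: real assume e: "e > 0"
  define K where "K = l / 2 * (norm (y' - y))\<^sup>2"
  \<comment> \<open>The added 1 covers \<open>K = 0\<close>, and the cap 1 keeps \<open>v\<close> on
    the segment.\<close>
  define t where "t = min 1 (e / (K + 1))"
  have K: "K \<ge> 0" using l by (simp add: K_def)
  have t: "0 < t" "t \<le> 1" using e K by (auto simp: t_def)
  have "t * K \<le> e / (K + 1) * K" using K by (intro mult_right_mono) (auto simp: t_def)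
  also have "\<dots> \<le> e" using K e by (simp add: field_simps)
  finally have tK: "t * K \<le> e" .
  define v where "v = (1 - t) *\<^sub>R y + t *\<^sub>R y'"
  have v: "v \<in> Y" "v - y = t *\<^sub>R (y' - y)"
    using convexD_alt[OF Y(2) y y', of t] t by (auto simp: v_def algebra_simps)
  have "(1 - t) * f (x, y) + t * f (x, y') \<le> f (x, v)"
    using conc[OF x] t y y' unfolding concave_on_iff v_def by auto
  also have "\<dots> \<le> f (x, y) + t * (gy x y \<bullet> (y' - y)) + t\<^sup>2 * K"
  proof -
    have "f (x, v) - f (x, y) - gy x y \<bullet> (v - y) \<le> l / 2 * (norm (v - y))\<^sup>2"
      using abs_le_D1[OF descent[of "(x, y)" "(x, v)"]] x y v(1)
      by (simp add: inner_prod_def norm_Pair)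
    then show ?thesis unfolding v(2) inner_scaleR_right norm_scaleR power_mult_distrib by (simp add: K_def algebra_simps)
  qed
  finally have "t * f (x, y') \<le> t * (f (x, y) + gy x y \<bullet> (y' - y) + t * K)"
    by (simp add: algebra_simps power2_eq_square)
  then show "f (x, y') \<le> f (x, y) + gy x y \<bullet> (y' - y) + e" using t tK by simp
qed

section \<open>The convexified saddle function and its operators\<close>

definition hx :: "'a \<Rightarrow> 'a \<Rightarrow> 'b \<Rightarrow> 'a" where
  "hx z x y = grad_x_Fhat l z x (gx x y)"

definition Fhat :: "'a \<Rightarrow> 'a \<Rightarrow> 'b \<Rightarrow> real" where
  "Fhat z x y = f (x, y) + l * (norm (x - z))\<^sup>2 - l / 2 * (norm x)\<^sup>2"

text \<open>The added quadratics amount to l/2 |x|^2 plus an affine function, which just compensates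
  the weak convexity left by smoothness. The l/2 |x|^2 subtracted in \<open>Fhat\<close> returns in
  conjugate form as the term |\<omega>|^2/(2l) of the dual function.\<close>

lemma Fhat_convex_x:
  assumes "x \<in> X" "x' \<in> X" "y \<in> Y"
  shows "Fhat z x y + hx z x y \<bullet> (x' - x) \<le> Fhat z x' y"
  using abs_le_D2[OF descent_x[OF assms]]
  unfolding Fhat_def hx_def grad_x_Fhat_def power2_norm_eq_inner
  by (simp add: inner_simps inner_commute algebra_simps)

lemma Fhat_concave_y:
  assumes "x \<in> X" "y \<in> Y" "y' \<in> Y"
  shows "Fhat z x y' \<le> Fhat z x y + gy x y \<bullet> (y' - y)"
  using concave_gradient[OF assms] by (simp add: Fhat_def)

text \<open>All function values cancel when the two convexity and the two concavity inequalities are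
  added.\<close>

lemma Fhat_monotone:
  assumes "x \<in> X" "x' \<in> X" "y \<in> Y" "y' \<in> Y"
  shows "0 \<le> (hx z x y - hx z x' y') \<bullet> (x - x') - (gy x y - gy x' y') \<bullet> (y - y')"
  using Fhat_convex_x[of x x' y z] Fhat_convex_x[of x' x y' z]
    Fhat_concave_y[of x y y' z] Fhat_concave_y[of x' y' y z] assms
  by (simp add: inner_simps algebra_simps)

text \<open>One family for two uses: \<open>a = l\<close>, \<open>b = r\<close> without shifts gives
  the optimality system of the regularised saddle point, and \<open>a = l / 2\<close>,
  \<open>b = r + l / 8\<close> the unscaled operator of the relative-prox procedure.\<close>

definition saddle_op :: "real \<Rightarrow> real \<Rightarrow> 'a \<Rightarrow> 'a \<Rightarrow> 'b \<Rightarrow> 'a \<times> 'b \<Rightarrow> 'a \<times> 'b" where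
  "saddle_op a b z cx cy = (\<lambda>(x, y). (hx z x y + a *\<^sub>R x + cx, - gy x y + b *\<^sub>R y + cy))"

lemma saddle_op_monotone:
  assumes "p \<in> X \<times> Y" "q \<in> X \<times> Y" "\<mu> \<le> a" "\<mu> \<le> b"
  shows "\<mu> * (norm (p - q))\<^sup>2 \<le> (saddle_op a b z cx cy p - saddle_op a b z cx cy q) \<bullet> (p - q)"
proof -
  obtain x y x' y' where pq: "p = (x, y)" "q = (x', y')" by (metis surj_pair)
  have "\<mu> * (norm (p - q))\<^sup>2 \<le> a * (norm (x - x'))\<^sup>2 + b * (norm (y - y'))\<^sup>2"
    using assms by (simp add: pq norm_Pair distrib_left add_mono mult_right_mono)
  also have "\<dots> \<le> (saddle_op a b z cx cy p - saddle_op a b z cx cy q) \<bullet> (p - q)"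
    using Fhat_monotone[of x x' y y' z] assms unfolding pq saddle_op_def power2_norm_eq_inner
    by (simp add: inner_prod_def inner_simps inner_commute algebra_simps)
  finally show ?thesis .
qed

lemma saddle_op_lipschitz:
  assumes "p \<in> X \<times> Y" "q \<in> X \<times> Y" "0 \<le> a" "0 \<le> b" "a \<le> c" "b \<le> c"
  shows "norm (saddle_op a b z cx cy p - saddle_op a b z cx cy q) \<le> (2 * l + c) * norm (p - q)"
proof -
  obtain x y x' y' where pq: "p = (x, y)" "q = (x', y')" by (metis surj_pair)
  define G where "G = (gx x y - gx x' y', - (gy x y - gy x' y'))"
  define H where "H = ((l + a) *\<^sub>R (x - x'), b *\<^sub>R (y - y'))"
  have two: "(l * 2) *\<^sub>R v = l *\<^sub>R v + l *\<^sub>R v" for v :: 'a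
    by (metis mult_2_right scaleR_add_left)
  have "saddle_op a b z cx cy p - saddle_op a b z cx cy q = G + H"
    by (simp add: G_def H_def pq saddle_op_def hx_def grad_x_Fhat_def algebra_simps two)
  moreover have "norm G = norm (g p - g q)"
    by (simp add: G_def pq norm_prod_def norm_minus_commute)
  then have "norm G \<le> l * norm (p - q)"
    using lipschitz_on_normD[OF lip assms(1,2)] by simp
  moreover have "norm H \<le> (l + c) * norm (p - q)"
  proof (rule power2_le_imp_le)
    have "(norm H)\<^sup>2 = (l + a)\<^sup>2 * (norm (x - x'))\<^sup>2 + b\<^sup>2 * (norm (y - y'))\<^sup>2"
      by (simp add: H_def norm_Pair power_mult_distrib)
    also have "\<dots> \<le> (l + c)\<^sup>2 * (norm (x - x'))\<^sup>2 + (l + c)\<^sup>2 * (norm (y - y'))\<^sup>2"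
      using assms l by (intro add_mono mult_right_mono power_mono) auto
    finally show "(norm H)\<^sup>2 \<le> ((l + c) * norm (p - q))\<^sup>2"
      by (simp add: pq norm_Pair power_mult_distrib distrib_left)
  qed (use assms l in auto)
  ultimately show ?thesis
    using norm_triangle_ineq[of G H] by (simp add: algebra_simps)
qed

text \<open>
  \<open>certified z x y \<omega> w\<close> says that \<open>(x, w)\<close> is a subgradient at \<open>(\<omega>, y)\<close> of the convex function
  \<open>G(\<omega>, y) = sup\<^bsub>x \<in> X\<^esub> (x \<bullet> \<omega> - Fhat z x y)\<close> plus the indicator of \<open>Y\<close>, with the supremum attained at \<open>x\<close>.
  Then \<open>dual_val\<close> is the value at \<open>(\<omega>, y)\<close> of the strongly convex function that FOAM minimises.
\<close>

definition certified :: "'a \<Rightarrow> 'a \<Rightarrow> 'b \<Rightarrow> 'a \<Rightarrow> 'b \<Rightarrow> bool" where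
  "certified z x y \<omega> w \<longleftrightarrow> x \<in> X \<and> y \<in> Y \<and>
     (\<forall>x'\<in>X. (\<omega> - hx z x y) \<bullet> (x' - x) \<le> 0) \<and> (\<forall>y'\<in>Y. (w + gy x y) \<bullet> (y' - y) \<le> 0)"

definition dual_val :: "'a \<Rightarrow> real \<Rightarrow> 'a \<Rightarrow> 'b \<Rightarrow> 'a \<Rightarrow> real" where
  "dual_val z r x y \<omega> = (norm \<omega>)\<^sup>2 / (2 * l) + r / 2 * (norm y)\<^sup>2 + x \<bullet> \<omega> - Fhat z x y"

text \<open>\<open>x1\<close> competes in the supremum that \<open>x2\<close> attains at
  \<open>(\<omega>2, y2)\<close>, and concavity of \<open>Fhat\<close> in y then leads from
  \<open>y2\<close> back to \<open>y1\<close>. The two quadratic terms expand exactly and supply the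
  moduli 1/l and r.\<close>

lemma dual_val_strongly_convex:
  assumes 1: "certified z x1 y1 \<omega>1 w1" and 2: "certified z x2 y2 \<omega>2 w2"
  shows "dual_val z r x1 y1 \<omega>1 + (x1 + (1 / l) *\<^sub>R \<omega>1) \<bullet> (\<omega>2 - \<omega>1) + (w1 + r *\<^sub>R y1) \<bullet> (y2 - y1)
      + (norm (\<omega>2 - \<omega>1))\<^sup>2 / (2 * l) + r / 2 * (norm (y2 - y1))\<^sup>2
    \<le> dual_val z r x2 y2 \<omega>2"
proof -
  have xy: "x1 \<in> X" "y1 \<in> Y" "x2 \<in> X" "y2 \<in> Y" using 1 2 by (auto simp: certified_def)
  have "Fhat z x2 y2 + hx z x2 y2 \<bullet> (x1 - x2) \<le> Fhat z x1 y2"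
    using xy by (intro Fhat_convex_x)
  moreover have "Fhat z x1 y2 \<le> Fhat z x1 y1 + gy x1 y1 \<bullet> (y2 - y1)"
    using xy by (intro Fhat_concave_y)
  moreover have "(\<omega>2 - hx z x2 y2) \<bullet> (x1 - x2) \<le> 0" "(w1 + gy x1 y1) \<bullet> (y2 - y1) \<le> 0"
    using 1 2 by (auto simp: certified_def)
  ultimately have "x1 \<bullet> \<omega>2 - Fhat z x1 y1 + w1 \<bullet> (y2 - y1) \<le> x2 \<bullet> \<omega>2 - Fhat z x2 y2"
    by (simp add: inner_simps inner_commute)
  moreover have "(norm \<omega>1)\<^sup>2 / (2 * l) + ((1 / l) *\<^sub>R \<omega>1) \<bullet> (\<omega>2 - \<omega>1) + (norm (\<omega>2 - \<omega>1))\<^sup>2 / (2 * l)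
      = (norm \<omega>2)\<^sup>2 / (2 * l)"
    unfolding power2_norm_eq_inner using l
    by (simp add: inner_simps inner_commute field_simps)
  moreover have "r / 2 * (norm y1)\<^sup>2 + (r *\<^sub>R y1) \<bullet> (y2 - y1) + r / 2 * (norm (y2 - y1))\<^sup>2
      = r / 2 * (norm y2)\<^sup>2"
    unfolding power2_norm_eq_inner
    by (simp add: inner_simps inner_commute algebra_simps)
  ultimately show ?thesis
    unfolding dual_val_def by (simp add: inner_simps)
qed

text \<open>With these dual variables both subgradient components
  \<open>x + (1 / l) *\<^sub>R \<omega>\<close> and \<open>w + r *\<^sub>R y\<close> of the strongly
  convex dual function vanish.\<close>

definition is_saddle :: "'a \<Rightarrow> real \<Rightarrow> 'a \<times> 'b \<Rightarrow> bool" where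
  "is_saddle z r p \<longleftrightarrow> certified z (fst p) (snd p) (- l *\<^sub>R fst p) (- r *\<^sub>R snd p)"

definition saddle_x :: "'a \<Rightarrow> real \<Rightarrow> 'a" where "saddle_x z r = fst (SOME p. is_saddle z r p)"
definition saddle_y :: "'a \<Rightarrow> real \<Rightarrow> 'b" where "saddle_y z r = snd (SOME p. is_saddle z r p)"

text \<open>The variational inequality of the strongly monotone saddle operator, tested on pairs
  that move one component only, splits into the two conditions of a certificate.\<close>

lemma saddle_certified:
  assumes "r > 0"
  shows "certified z (saddle_x z r) (saddle_y z r) (- l *\<^sub>R saddle_x z r) (- r *\<^sub>R saddle_y z r)"
proof -
  interpret monotone_operator "X \<times> Y" "saddle_op l r z 0 0" "min l r" "2 * l + max l r"
    using X Y assms l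
    by unfold_locales
      (auto simp: complete_Times convex_Times simp del: mem_Times_iff
        intro!: saddle_op_monotone saddle_op_lipschitz)
  obtain p where p: "p \<in> X \<times> Y" "\<And>q. q \<in> X \<times> Y \<Longrightarrow> 0 \<le> saddle_op l r z 0 0 p \<bullet> (q - p)"
  proof -
    have "0 < min l r" "min l r \<le> 2 * l + max l r" using l assms by auto
    from variational_inequality[OF this] show thesis using that by blast
  qed
  have "is_saddle z r p"
    unfolding is_saddle_def certified_def
  proof (intro conjI ballI)
    fix x' assume "x' \<in> X"
    then show "(- l *\<^sub>R fst p - hx z (fst p) (snd p)) \<bullet> (x' - fst p) \<le> 0"
      using p(1) p(2)[of "(x', snd p)"]
      by (auto simp: saddle_op_def case_prod_beta inner_prod_def inner_simps)
  next
    fix y' assume "y' \<in> Y"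
    then show "(- r *\<^sub>R snd p + gy (fst p) (snd p)) \<bullet> (y' - snd p) \<le> 0"
      using p(1) p(2)[of "(fst p, y')"]
      by (auto simp: saddle_op_def case_prod_beta inner_prod_def inner_simps)
  qed (use p in auto)
  then show ?thesis
    unfolding saddle_x_def saddle_y_def is_saddle_def[symmetric] prod.collapse
    using someI[of "is_saddle z r"] is_saddle_def by auto
qed

lemma saddle_in:
  assumes "r > 0" shows "saddle_x z r \<in> X" "saddle_y z r \<in> Y"
  using saddle_certified[OF assms] by (auto simp: certified_def)

end

section \<open>The relative-prox procedure\<close>

text \<open>Converts the stopping test into the inexactness condition of an accelerated proximal
  step. The y part is the test itself with its square expanded; in the \<omega> part the test has
  another shape, and a completed square bridges the difference.\<close>

lemma relative_error_inequality:
  fixes xf \<omega>f \<omega>g :: "'a::real_inner" and yf yg wf :: "'b::real_inner"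
  assumes l: "l > 0"
    and stop: "(8 / l) * ((norm (\<omega>f + (l / 2) *\<^sub>R xf - (1 / 2) *\<^sub>R \<omega>g))\<^sup>2
        + (norm (wf + r *\<^sub>R yf + (l / 8) *\<^sub>R (yf - yg)))\<^sup>2)
      \<le> (l / 8) * ((norm (xf + (1 / l) *\<^sub>R \<omega>g))\<^sup>2 + (norm (yf - yg))\<^sup>2)"
  shows "2 * ((xf + (1 / l) *\<^sub>R \<omega>f) \<bullet> (\<omega>f - \<omega>g)) + 2 * ((wf + r *\<^sub>R yf) \<bullet> (yf - yg))
      + (8 / l) * (norm (wf + r *\<^sub>R yf))\<^sup>2 + l * (norm (xf + (1 / l) *\<^sub>R \<omega>f))\<^sup>2 \<le> 0"
proof -
  define p \<delta> q \<kappa> where "p = xf + (1 / l) *\<^sub>R \<omega>f" and "\<delta> = (1 / l) *\<^sub>R (\<omega>f - \<omega>g)"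
    and "q = wf + r *\<^sub>R yf" and "\<kappa> = yf - yg"
  have eqs: "\<omega>f + (l / 2) *\<^sub>R xf - (1 / 2) *\<^sub>R \<omega>g = (l / 2) *\<^sub>R (p + \<delta>)"
    "xf + (1 / l) *\<^sub>R \<omega>g = p - \<delta>" "\<omega>f - \<omega>g = l *\<^sub>R \<delta>"
    using l by (simp_all add: p_def \<delta>_def algebra_simps flip: scaleR_add_left)
  \<comment> \<open>The difference to be bounded below is 7/8 |p|^2 + 9/4 (p \<bullet> \<delta>) +
    15/8 |\<delta>|^2. The shift 9/7 completes the square and leaves 3/7 |\<delta>|^2.\<close>
  have "0 \<le> (7 / 8) * (norm (p + (9 / 7) *\<^sub>R \<delta>))\<^sup>2 + (1 / 4) * (norm \<delta>)\<^sup>2" by simp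
  also have "\<dots> \<le> 2 * (norm (p + \<delta>))\<^sup>2 - (norm (p - \<delta>))\<^sup>2 / 8 - 2 * (p \<bullet> \<delta>) - (norm p)\<^sup>2"
    using inner_ge_zero[of \<delta>] unfolding power2_norm_eq_inner
    by (simp add: inner_simps inner_commute field_simps)
  finally have "l * 0 \<le> l * (2 * (norm (p + \<delta>))\<^sup>2 - (norm (p - \<delta>))\<^sup>2 / 8 - 2 * (p \<bullet> \<delta>) - (norm p)\<^sup>2)"
    using l by (intro mult_left_mono) auto
  moreover have e1: "(8 / l) * (norm ((l / 2) *\<^sub>R (p + \<delta>)))\<^sup>2 = 2 * (l * (norm (p + \<delta>))\<^sup>2)"
    unfolding norm_scaleR power_mult_distrib using l by (simp add: field_simps power2_eq_square)
  moreover have e2: "(8 / l) * (norm (q + (l / 8) *\<^sub>R \<kappa>))\<^sup>2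
      = (8 / l) * (norm q)\<^sup>2 + 2 * (q \<bullet> \<kappa>) + (l / 8) * (norm \<kappa>)\<^sup>2"
    unfolding power2_norm_eq_inner using l
    by (simp add: inner_simps inner_commute field_simps)
  moreover have "2 * (l * (norm (p + \<delta>))\<^sup>2) + ((8 / l) * (norm q)\<^sup>2 + 2 * (q \<bullet> \<kappa>) + (l / 8) * (norm \<kappa>)\<^sup>2)
      \<le> (l / 8) * (norm (p - \<delta>))\<^sup>2 + (l / 8) * (norm \<kappa>)\<^sup>2"
    using stop unfolding eqs q_def[symmetric] \<kappa>_def[symmetric] distrib_left e1 e2 .
  ultimately have "2 * (l * (p \<bullet> \<delta>)) + 2 * (q \<bullet> \<kappa>) + (8 / l) * (norm q)\<^sup>2 + l * (norm p)\<^sup>2 \<le> 0"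
    by (simp add: right_diff_distrib)
  then show ?thesis
    unfolding eqs(3) p_def[symmetric] q_def[symmetric] \<kappa>_def[symmetric] by simp
qed

context smooth_saddle
begin

text \<open>The scaling by \<open>k\<close>, with \<open>k * k = 8 / l\<close>, turns the constants
  l/8 and 5l/2 of the operator into 1 and 20, so the fixed iteration budget applies. The calls are
  one at the start, one in the first step and at most \<open>prox_budget\<close> in the
  loop.\<close>

lemma rel_prox_run:
  assumes r: "0 < r" "r \<le> l / 8"
  obtains xf yf \<omega>f wf k where
    "rel_prox (saddle_oracle X Y f g) X Y l z r (\<omega>g, yg) = Some ((xf, yf, \<omega>f, wf), k)"
    "k \<le> prox_budget + 2" "certified z xf yf \<omega>f wf"
    "2 * ((xf + (1 / l) *\<^sub>R \<omega>f) \<bullet> (\<omega>f - \<omega>g)) + 2 * ((wf + r *\<^sub>R yf) \<bullet> (yf - yg))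
      + (8 / l) * (norm (wf + r *\<^sub>R yf))\<^sup>2 + l * (norm (xf + (1 / l) *\<^sub>R \<omega>f))\<^sup>2 \<le> 0"
proof -
  define k where "k = sqrt (8 / l)"
  have k: "k > 0" "k * k = 8 / l" using l by (auto simp: k_def)
  have kkl: "k * (k * l) = 8" using k(2) l by (simp add: field_simps)
  have kk: "k *\<^sub>R ((1 / k) *\<^sub>R v) = v" "(1 / k) *\<^sub>R (k *\<^sub>R v) = v" for v :: "'a \<times> 'b"
    using k by auto
  define C where "C = (\<lambda>p. (1 / k) *\<^sub>R p) ` (X \<times> Y)"
  define B where "B = saddle_op (l / 2) (r + l / 8) z (- (1 / 2) *\<^sub>R \<omega>g) (- (l / 8) *\<^sub>R yg)"
  define A where "A u = k *\<^sub>R B (k *\<^sub>R u)" for u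
  define uinit where "uinit = (1 / k) *\<^sub>R (- (1 / l) *\<^sub>R \<omega>g, yg)"
  define ans where "ans u = (f (k *\<^sub>R u), fst (g (k *\<^sub>R u)), snd (g (k *\<^sub>R u)))" for u
  have in_C: "k *\<^sub>R u \<in> X \<times> Y" if "u \<in> C" for u using that kk unfolding C_def by auto
  have C: "complete C" "convex C" "C \<noteq> {}"
  proof -
    show "convex C" unfolding C_def using X Y by (intro convex_scaling convex_Times)
    show "C \<noteq> {}" unfolding C_def using X Y by auto
    show "complete C"
      unfolding complete_def
    proof (intro allI impI)
      fix s assume s: "(\<forall>n. s n \<in> C) \<and> Cauchy s"
      then have "Cauchy (\<lambda>n. k *\<^sub>R s n)"
        by (auto intro!: bounded_linear.Cauchy[OF bounded_linear_scaleR_right])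
      then obtain p where p: "p \<in> X \<times> Y" "(\<lambda>n. k *\<^sub>R s n) \<longlonglongrightarrow> p"
        using completeE[OF complete_Times[OF X(1) Y(1)], of "\<lambda>n. k *\<^sub>R s n"] s in_C by blast
      have "s \<longlonglongrightarrow> (1 / k) *\<^sub>R p" using tendsto_scaleR[OF tendsto_const p(2), of "1 / k"] k by simp
      with p(1) show "\<exists>p\<in>C. s \<longlonglongrightarrow> p" unfolding C_def by blast
    qed
  qed
  interpret monotone_operator C A 1 20
  proof
    fix u v assume uv: "u \<in> C" "v \<in> C"
    have "(l / 8) * (norm (k *\<^sub>R u - k *\<^sub>R v))\<^sup>2 = k * (k * l) / 8 * (norm (u - v))\<^sup>2"
      by (simp add: power_mult_distrib power2_eq_square flip: scaleR_diff_right)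
    then have "1 * (norm (u - v))\<^sup>2 = (l / 8) * (norm (k *\<^sub>R u - k *\<^sub>R v))\<^sup>2"
      unfolding kkl by simp
    also have "\<dots> \<le> (B (k *\<^sub>R u) - B (k *\<^sub>R v)) \<bullet> (k *\<^sub>R u - k *\<^sub>R v)"
      unfolding B_def using uv r l by (intro saddle_op_monotone in_C) auto
    also have "\<dots> = (A u - A v) \<bullet> (u - v)"
      by (simp add: A_def flip: scaleR_diff_right)
    finally show "1 * (norm (u - v))\<^sup>2 \<le> (A u - A v) \<bullet> (u - v)" .
    have "norm (A u - A v) = k * norm (B (k *\<^sub>R u) - B (k *\<^sub>R v))"
      using k by (simp add: A_def flip: scaleR_diff_right)
    also have "\<dots> \<le> k * ((2 * l + l / 2) * norm (k *\<^sub>R u - k *\<^sub>R v))"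
      unfolding B_def using uv r l k by (intro mult_left_mono saddle_op_lipschitz in_C) auto
    also have "\<dots> = k * (k * l) * (5 / 2) * norm (u - v)"
      using k(1) by (simp flip: scaleR_diff_right)
    also have "\<dots> = 20 * norm (u - v)" by (simp add: kkl)
    finally show "norm (A u - A v) \<le> 20 * norm (u - v)" .
  qed (rule C)+
  have A_op: "A_op l z r (\<omega>g, yg) u (ans u) = A u" for u
  proof -
    obtain x y where xy: "k *\<^sub>R u = (x, y)" by fastforce
    show ?thesis
      using l unfolding A_op_def ans_def A_def B_def prod.case Let_def k_def[symmetric] saddle_op_def xy hx_def
      by (simp add: algebra_simps)
  qed
  define u where "u s = (proj_step C (1 / 1024) A ^^ s) (proj C uinit)" for s
  define b where "b s = 1024 *\<^sub>R (u s - u (Suc s)) - A (u s)" for s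
  \<comment> \<open>Shifted by one: a step is taken before the first test, so the loop starts at
    \<open>u 1\<close>.\<close>
  define state where "state i = (u (Suc i), ans (u (Suc i)), b i)" for i
  have u_Suc: "u (Suc s) = proj C (u s - (1 / 1024) *\<^sub>R A (u s))" for s
    by (simp add: u_def proj_step_def)
  have u_in: "u s \<in> C" for s
    using proj_in[OF C] u_Suc by (cases s) (auto simp: u_def[of 0])
  have orc: "saddle_oracle X Y f g (k *\<^sub>R u s) = Some (ans (u s), 1)" for s
    using in_C[OF u_in[of s]] by (simp add: saddle_oracle_def ans_def)
  define step where "step = (\<lambda>(u, a, b :: 'a \<times> 'b).
            let u' = proj C (u - (1 / 32\<^sup>2) *\<^sub>R A_op l z r (\<omega>g, yg) u a);
                b' = (1 / (1 / 32\<^sup>2)) *\<^sub>R (u - u') - A_op l z r (\<omega>g, yg) u a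
            in saddle_oracle X Y f g (k *\<^sub>R u') \<bind>\<^sub>r (\<lambda>a'. run_return (u', a', b')))"
  define stop where "stop = (\<lambda>(u, a, b). norm (A_op l z r (\<omega>g, yg) u a + b) \<le> norm (u - uinit))"
  have step: "step (u s, ans (u s), b') = Some (state s, 1)" for s b'
    unfolding step_def
    by (simp add: A_op Let_def orc run_bind_def run_return_def state_def b_def flip: u_Suc[simplified])
  have "stop (state prox_budget)"
    using relative_residual[OF refl refl, of u uinit] by (simp add: u_def stop_def state_def A_op b_def)
  then obtain n where n: "n \<le> prox_budget" "stop (state n)"
      "run_until stop step (state 0) = Some (state n, n)"
    using run_until_sequence[of step state] step by (auto simp: state_def)
  define xf yf where "xf = fst (k *\<^sub>R u (Suc n))" and "yf = snd (k *\<^sub>R u (Suc n))"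
  define bx bY where "bx = fst ((1 / k) *\<^sub>R b n)" and "bY = snd ((1 / k) *\<^sub>R b n)"
  define \<omega>f wf where "\<omega>f = hx z xf yf + bx" and "wf = - gy xf yf + bY"
  have ku: "k *\<^sub>R u (Suc n) = (xf, yf)" and kb: "(1 / k) *\<^sub>R b n = (bx, bY)"
    unfolding xf_def yf_def bx_def bY_def prod.collapse by (rule refl)+
  have run: "rel_prox (saddle_oracle X Y f g) X Y l z r (\<omega>g, yg) = Some ((xf, yf, \<omega>f, wf), n + 2)"
  proof -
    have "rel_prox (saddle_oracle X Y f g) X Y l z r (\<omega>g, yg) =
      (saddle_oracle X Y f g (k *\<^sub>R u 0) \<bind>\<^sub>r (\<lambda>a0. step (u 0, a0, 0)) \<bind>\<^sub>r run_until stop step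
         \<bind>\<^sub>r (\<lambda>(u, (_, gx, gy), b).
            let (xf, yf) = k *\<^sub>R u; (bx, by) = (1 / k) *\<^sub>R b
            in run_return (xf, yf, grad_x_Fhat l z xf gx + bx, - gy + by)))"
      unfolding rel_prox_def Let_def k_def[symmetric] C_def[symmetric] step_def stop_def uinit_def u_def
      by simp
    also have "\<dots> = Some ((xf, yf, \<omega>f, wf), n + 2)"
      apply (simp only: run_bind_def orc step n(3) Option.bind.simps prod.case)
      apply (simp only: state_def ans_def ku kb prod.case Let_def run_return_def Option.bind.simps)
      by (simp add: \<omega>f_def wf_def hx_def)
    finally show ?thesis .
  qed
  \<comment> \<open>\<open>b n\<close> is a multiple of the residual of the projection that produced
    \<open>u (Suc n)\<close>, hence normal to \<open>C\<close> there. This makes the output a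
    certificate even though the iteration is stopped early.\<close>
  have normal: "(bx, bY) \<bullet> (p - (xf, yf)) \<le> 0" if "p \<in> X \<times> Y" for p
  proof -
    have "(1 / k) *\<^sub>R p \<in> C" unfolding C_def using that by (rule imageI)
    from inner_proj_le_0[OF C this, of "u n - (1 / 1024) *\<^sub>R A (u n)"]
    have "((1 / 1024) *\<^sub>R b n) \<bullet> ((1 / k) *\<^sub>R p - u (Suc n)) \<le> 0"
      unfolding u_Suc[symmetric] b_def by (simp add: algebra_simps)
    moreover have "((1 / 1024) *\<^sub>R b n) \<bullet> ((1 / k) *\<^sub>R p - u (Suc n)) =
        (1 / 1024) * (((1 / k) *\<^sub>R b n) \<bullet> (p - k *\<^sub>R u (Suc n)))"
      using k by (simp add: inner_simps field_simps)
    ultimately show ?thesis unfolding ku kb by simp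
  qed
  have xy: "xf \<in> X" "yf \<in> Y" using in_C[OF u_in[of "Suc n"]] by (auto simp: ku)
  have "certified z xf yf \<omega>f wf"
    unfolding certified_def
  proof (intro conjI ballI xy)
    show "(\<omega>f - hx z xf yf) \<bullet> (x' - xf) \<le> 0" if "x' \<in> X" for x'
      using normal[of "(x', yf)"] that xy by (simp add: \<omega>f_def inner_prod_def)
    show "(wf + gy xf yf) \<bullet> (y' - yf) \<le> 0" if "y' \<in> Y" for y'
      using normal[of "(xf, y')"] that xy by (simp add: wf_def inner_prod_def)
  qed
  moreover have "2 * ((xf + (1 / l) *\<^sub>R \<omega>f) \<bullet> (\<omega>f - \<omega>g)) + 2 * ((wf + r *\<^sub>R yf) \<bullet> (yf - yg))
      + (8 / l) * (norm (wf + r *\<^sub>R yf))\<^sup>2 + l * (norm (xf + (1 / l) *\<^sub>R \<omega>f))\<^sup>2 \<le> 0"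
  proof (rule relative_error_inequality[OF l])
    let ?R = "(\<omega>f + (l / 2) *\<^sub>R xf - (1 / 2) *\<^sub>R \<omega>g, wf + r *\<^sub>R yf + (l / 8) *\<^sub>R (yf - yg))"
    let ?S = "(xf + (1 / l) *\<^sub>R \<omega>g, yf - yg)"
    have b: "b n = k *\<^sub>R (bx, bY)" using kk(1)[of "b n"] kb by simp
    have "A (u (Suc n)) + b n = k *\<^sub>R ?R"
      unfolding A_def ku b B_def saddle_op_def
      by (simp add: \<omega>f_def wf_def algebra_simps)
    moreover have "u (Suc n) - uinit = (1 / k) *\<^sub>R ?S"
      using kk(2)[of "u (Suc n)"] unfolding ku uinit_def
      by (metis (no_types, lifting) diff_Pair diff_minus_eq_add scaleR_diff_right scaleR_minus_left)
    ultimately have "norm (k *\<^sub>R ?R) \<le> norm ((1 / k) *\<^sub>R ?S)"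
      using n(2) by (simp add: stop_def state_def A_op)
    then have "(norm (k *\<^sub>R ?R))\<^sup>2 \<le> (norm ((1 / k) *\<^sub>R ?S))\<^sup>2" by (intro power_mono) auto
    then have "(k * k) * (norm ?R)\<^sup>2 \<le> 1 / (k * k) * (norm ?S)\<^sup>2"
      unfolding norm_scaleR power_mult_distrib by (simp add: power2_eq_square)
    then show "(8 / l) * ((norm (\<omega>f + (l / 2) *\<^sub>R xf - (1 / 2) *\<^sub>R \<omega>g))\<^sup>2
        + (norm (wf + r *\<^sub>R yf + (l / 8) *\<^sub>R (yf - yg)))\<^sup>2)
      \<le> (l / 8) * ((norm (xf + (1 / l) *\<^sub>R \<omega>g))\<^sup>2 + (norm (yf - yg))\<^sup>2)"
      by (simp add: k norm_Pair)
  qed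
  ultimately show thesis using that[OF run] n(1) by simp
qed

end

section \<open>Linear convergence of FOAM\<close>

text \<open>The difference of the two sides is a combination of two squares with nonnegative
  coefficients. The \<omega> update is the borderline case \<open>2 * \<eta> * r = 1\<close>; in the
  y update this product is \<alpha>.\<close>

lemma accelerated_step_bound:
  fixes v vf v' q c :: "'a::real_inner"
  assumes "\<eta> > 0" "r \<ge> 0" "2 * \<eta> * r \<le> 1" and v': "v' = v + (\<eta> * r) *\<^sub>R (vf - v) - \<eta> *\<^sub>R q"
  shows "(1 / \<eta>) * (norm (v' - c))\<^sup>2 \<le> (1 / \<eta> - r) * (norm (v - c))\<^sup>2
      + r * (norm (vf - c))\<^sup>2 - 2 * (q \<bullet> (v - c)) + 2 * \<eta> * (norm q)\<^sup>2"
proof -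
  define a b where "a = v - c" and "b = vf - c"
  have d: "v' - c = a + (\<eta> * r) *\<^sub>R (b - a) - \<eta> *\<^sub>R q" by (simp add: v' a_def b_def)
  have "(1 / \<eta>) * (norm (v' - c))\<^sup>2
      = (1 / \<eta> - r) * (norm a)\<^sup>2 + r * (norm b)\<^sup>2 - 2 * (q \<bullet> a) + 2 * \<eta> * (norm q)\<^sup>2
        - \<eta> * (norm (r *\<^sub>R (b - a) + q))\<^sup>2 - r * (1 - 2 * \<eta> * r) * (norm (b - a))\<^sup>2"
    unfolding d power2_norm_eq_inner using assms(1)
    by (simp add: inner_simps inner_commute field_simps)
  moreover have "0 \<le> \<eta> * (norm (r *\<^sub>R (b - a) + q))\<^sup>2" "0 \<le> r * (1 - 2 * \<eta> * r) * (norm (b - a))\<^sup>2"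
    using assms by auto
  ultimately show ?thesis unfolding a_def b_def by linarith
qed

context smooth_saddle
begin

definition alpha :: "real \<Rightarrow> real" where
  "alpha r = sqrt (8 * r / l)"

lemma alpha:
  assumes "0 < r" "r \<le> l / 8"
  shows "0 < alpha r" "alpha r \<le> 1" "(alpha r)\<^sup>2 = 8 * r / l"
  using assms l by (auto simp: alpha_def)

definition dual_gap :: "'a \<Rightarrow> real \<Rightarrow> 'a \<Rightarrow> 'b \<Rightarrow> 'a \<Rightarrow> real" where
  "dual_gap z r x y \<omega> =
     dual_val z r x y \<omega> - dual_val z r (saddle_x z r) (saddle_y z r) (- l *\<^sub>R saddle_x z r)"

text \<open>At the saddle certificate the linear terms of the strong convexity inequality
  vanish.\<close>

lemma dual_gap_lower:
  assumes "r > 0" "certified z x y \<omega> w"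
  shows "(norm (\<omega> + l *\<^sub>R saddle_x z r))\<^sup>2 / (2 * l) + r / 2 * (norm (y - saddle_y z r))\<^sup>2
    \<le> dual_gap z r x y \<omega>"
  using dual_val_strongly_convex[OF saddle_certified[OF assms(1)] assms(2), of r] l
  by (simp add: dual_gap_def)

text \<open>A predicate rather than a function, because the state does not store the witnesses
  \<open>xf\<close> and \<open>wf\<close>. The weights of the distances are \<alpha>/2 times the
  inverse step sizes of the two updates.\<close>

definition foam_err :: "'a \<Rightarrow> real \<Rightarrow> ('a, 'b) foam_state \<Rightarrow> real \<Rightarrow> bool" where
  "foam_err z r = (\<lambda>(\<omega>, y, \<omega>f, yf) e. \<exists>xf wf. certified z xf yf \<omega>f wf \<and>
     dual_gap z r xf yf \<omega>f + alpha r / l * (norm (\<omega> + l *\<^sub>R saddle_x z r))\<^sup>2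
       + r * (norm (y - saddle_y z r))\<^sup>2 \<le> e)"

lemma foam_err_mono: "foam_err z r S e \<Longrightarrow> e \<le> e' \<Longrightarrow> foam_err z r S e'"
  unfolding foam_err_def by (auto split: prod.splits intro: order_trans)

lemma foam_err_nonneg:
  assumes "r > 0" "foam_err z r S e"
  shows "0 \<le> e"
proof -
  obtain \<omega> y \<omega>f yf xf wf where "certified z xf yf \<omega>f wf"
    and e: "dual_gap z r xf yf \<omega>f + alpha r / l * (norm (\<omega> + l *\<^sub>R saddle_x z r))\<^sup>2
       + r * (norm (y - saddle_y z r))\<^sup>2 \<le> e"
    using assms(2) unfolding foam_err_def by (auto split: prod.splits)
  have "0 \<le> (norm (\<omega>f + l *\<^sub>R saddle_x z r))\<^sup>2 / (2 * l) + r / 2 * (norm (yf - saddle_y z r))\<^sup>2"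
    using assms l by simp
  also have "\<dots> \<le> dual_gap z r xf yf \<omega>f" by (rule dual_gap_lower) fact+
  finally have "0 \<le> dual_gap z r xf yf \<omega>f" .
  moreover have "0 \<le> alpha r / l * (norm (\<omega> + l *\<^sub>R saddle_x z r))\<^sup>2 + r * (norm (y - saddle_y z r))\<^sup>2"
    using assms l by (simp add: alpha_def)
  ultimately show ?thesis using e by linarith
qed

text \<open>Both update bounds are multiplied by \<alpha>/2. The squared subgradients
  \<open>p\<close> and \<open>q\<close> that they create are no larger than those which the relative
  error inequality pays for.\<close>

lemma foam_step_run:
  assumes r: "0 < r" "r \<le> l / 8" and S: "foam_err z r S e"
  shows "\<exists>S' k. foam_step (saddle_oracle X Y f g) X Y l z r S = Some (S', k) \<and>
    k \<le> prox_budget + 2 \<and> foam_err z r S' ((1 - alpha r / 2) * e)"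
proof -
  define \<alpha> where "\<alpha> = alpha r"
  have \<alpha>: "0 < \<alpha>" "\<alpha> \<le> 1" and \<alpha>2: "\<alpha>\<^sup>2 = 8 * r / l" using alpha[OF r] by (simp_all add: \<alpha>_def)
  have \<alpha>r: "r = \<alpha> * \<alpha> * l / 8" using \<alpha>2 l by (simp add: power2_eq_square field_simps)
  define xs ys where "xs = saddle_x z r" and "ys = saddle_y z r"
  obtain \<omega> y \<omega>f yf where S_eq: "S = (\<omega>, y, \<omega>f, yf)" by (cases S)
  obtain xf0 wf0 where cert0: "certified z xf0 yf \<omega>f wf0"
    and e: "dual_gap z r xf0 yf \<omega>f + \<alpha> / l * (norm (\<omega> + l *\<^sub>R xs))\<^sup>2 + r * (norm (y - ys))\<^sup>2 \<le> e"
    using S unfolding foam_err_def S_eq by (auto simp: \<alpha>_def xs_def ys_def)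
  define \<omega>g yg where "\<omega>g = \<alpha> *\<^sub>R \<omega> + (1 - \<alpha>) *\<^sub>R \<omega>f" and "yg = \<alpha> *\<^sub>R y + (1 - \<alpha>) *\<^sub>R yf"
  obtain xf yf' \<omega>f' wf k where run:
    "rel_prox (saddle_oracle X Y f g) X Y l z r (\<omega>g, yg) = Some ((xf, yf', \<omega>f', wf), k)"
    "k \<le> prox_budget + 2" and cert: "certified z xf yf' \<omega>f' wf" and rel:
    "2 * ((xf + (1 / l) *\<^sub>R \<omega>f') \<bullet> (\<omega>f' - \<omega>g)) + 2 * ((wf + r *\<^sub>R yf') \<bullet> (yf' - yg))
      + (8 / l) * (norm (wf + r *\<^sub>R yf'))\<^sup>2 + l * (norm (xf + (1 / l) *\<^sub>R \<omega>f'))\<^sup>2 \<le> 0"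
    using rel_prox_run[OF r] by metis
  define p q where "p = xf + (1 / l) *\<^sub>R \<omega>f'" and "q = wf + r *\<^sub>R yf'"
  define \<omega>' where "\<omega>' = \<omega> + (l / 2 * (1 / l)) *\<^sub>R (\<omega>f' - \<omega>) - (l / 2) *\<^sub>R p"
  define y' where "y' = y + (4 / (\<alpha> * l) * r) *\<^sub>R (yf' - y) - (4 / (\<alpha> * l)) *\<^sub>R q"
  have step: "foam_step (saddle_oracle X Y f g) X Y l z r S = Some ((\<omega>', y', \<omega>f', yf'), k)"
    unfolding foam_step_def S_eq Let_def prod.case
    unfolding alpha_def[symmetric] \<alpha>_def[symmetric] \<omega>g_def[symmetric] yg_def[symmetric] run(1)
    by (simp add: run_bind_def run_return_def \<omega>'_def y'_def p_def q_def)
  define c where "c = - l *\<^sub>R xs"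
  have os: "v + l *\<^sub>R xs = v - c" for v by (simp add: c_def)
  have "1 / (l / 2) * (norm (\<omega>' - c))\<^sup>2 \<le> (1 / (l / 2) - 1 / l) * (norm (\<omega> - c))\<^sup>2
      + 1 / l * (norm (\<omega>f' - c))\<^sup>2 - 2 * (p \<bullet> (\<omega> - c)) + 2 * (l / 2) * (norm p)\<^sup>2"
    using l by (intro accelerated_step_bound) (auto simp: \<omega>'_def)
  from mult_left_mono[OF this, of "\<alpha> / 2"] have bx: "\<alpha> / l * (norm (\<omega>' - c))\<^sup>2
      \<le> \<alpha> / (2 * l) * (norm (\<omega> - c))\<^sup>2 + \<alpha> / (2 * l) * (norm (\<omega>f' - c))\<^sup>2
        - \<alpha> * (p \<bullet> (\<omega> - c)) + \<alpha> * l / 2 * (norm p)\<^sup>2"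
    using \<alpha> l by (simp add: field_simps)
  have "1 / (4 / (\<alpha> * l)) * (norm (y' - ys))\<^sup>2 \<le> (1 / (4 / (\<alpha> * l)) - r) * (norm (y - ys))\<^sup>2
      + r * (norm (yf' - ys))\<^sup>2 - 2 * (q \<bullet> (y - ys)) + 2 * (4 / (\<alpha> * l)) * (norm q)\<^sup>2"
    using l \<alpha> r by (intro accelerated_step_bound) (auto simp: y'_def \<alpha>r field_simps)
  moreover have "1 / (4 / (\<alpha> * l)) = \<alpha> * l / 4" "2 * (4 / (\<alpha> * l)) = 2 / \<alpha> * (4 / l)" by simp_all
  ultimately have "\<alpha> * l / 4 * (norm (y' - ys))\<^sup>2 \<le> (\<alpha> * l / 4 - r) * (norm (y - ys))\<^sup>2
      + r * (norm (yf' - ys))\<^sup>2 - 2 * (q \<bullet> (y - ys)) + 2 / \<alpha> * (4 / l * (norm q)\<^sup>2)"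
    by (simp only: mult.assoc)
  from mult_left_mono[OF this, of "\<alpha> / 2"] have "\<alpha> * \<alpha> * l / 8 * (norm (y' - ys))\<^sup>2
      \<le> (\<alpha> * \<alpha> * l / 8 - \<alpha> * r / 2) * (norm (y - ys))\<^sup>2 + \<alpha> * r / 2 * (norm (yf' - ys))\<^sup>2
        - \<alpha> * (q \<bullet> (y - ys)) + \<alpha> / 2 * (2 / \<alpha> * (4 / l * (norm q)\<^sup>2))"
    using \<alpha>(1) by (simp add: algebra_simps)
  moreover have "\<alpha> / 2 * (2 / \<alpha> * (4 / l * (norm q)\<^sup>2)) = 4 / l * (norm q)\<^sup>2"
    using \<alpha>(1) by simp
  ultimately have byy: "r * (norm (y' - ys))\<^sup>2
      \<le> (r - \<alpha> * r / 2) * (norm (y - ys))\<^sup>2 + \<alpha> * r / 2 * (norm (yf' - ys))\<^sup>2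
        - \<alpha> * (q \<bullet> (y - ys)) + 4 / l * (norm q)\<^sup>2"
    by (simp only: flip: \<alpha>r)
  \<comment> \<open>Because \<open>\<omega>g\<close> averages \<open>\<omega>\<close> and
    \<open>\<omega>f\<close>, the linear term splits into the proximal displacement, handled by
    \<open>rel\<close>, and comparisons of the new point with the old one and with the minimiser,
    handled by strong convexity.\<close>
  have "\<alpha> *\<^sub>R (\<omega> - c) = (\<omega>g - \<omega>f') - (1 - \<alpha>) *\<^sub>R (\<omega>f - \<omega>f') - \<alpha> *\<^sub>R (c - \<omega>f')"
    by (simp add: \<omega>g_def algebra_simps)
  from arg_cong[OF this, of "\<lambda>v. p \<bullet> v"]
  have ex: "\<alpha> * (p \<bullet> (\<omega> - c)) = - (p \<bullet> (\<omega>f' - \<omega>g)) - (1 - \<alpha>) * (p \<bullet> (\<omega>f - \<omega>f')) - \<alpha> * (p \<bullet> (c - \<omega>f'))"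
    by (simp add: inner_diff_right)
  have "\<alpha> *\<^sub>R (y - ys) = (yg - yf') - (1 - \<alpha>) *\<^sub>R (yf - yf') - \<alpha> *\<^sub>R (ys - yf')"
    by (simp add: yg_def algebra_simps)
  from arg_cong[OF this, of "\<lambda>v. q \<bullet> v"]
  have ey: "\<alpha> * (q \<bullet> (y - ys)) = - (q \<bullet> (yf' - yg)) - (1 - \<alpha>) * (q \<bullet> (yf - yf')) - \<alpha> * (q \<bullet> (ys - yf'))"
    by (simp add: inner_diff_right)
  let ?G = "dual_gap z r xf0 yf \<omega>f" and ?G' = "dual_gap z r xf yf' \<omega>f'"
  have "0 \<le> (norm (\<omega>f - \<omega>f'))\<^sup>2 / (2 * l) + r / 2 * (norm (yf - yf'))\<^sup>2" using l r by simp
  then have "p \<bullet> (\<omega>f - \<omega>f') + q \<bullet> (yf - yf') \<le> ?G - ?G'"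
    using dual_val_strongly_convex[OF cert cert0, of r] unfolding dual_gap_def p_def q_def by linarith
  from mult_left_mono[OF this, of "1 - \<alpha>"]
  have c0: "(1 - \<alpha>) * (p \<bullet> (\<omega>f - \<omega>f')) + (1 - \<alpha>) * (q \<bullet> (yf - yf')) \<le> (1 - \<alpha>) * ?G - (1 - \<alpha>) * ?G'"
    using \<alpha> by (simp add: distrib_left right_diff_distrib)
  have "p \<bullet> (c - \<omega>f') + q \<bullet> (ys - yf') + (norm (\<omega>f' - c))\<^sup>2 / (2 * l) + r / 2 * (norm (yf' - ys))\<^sup>2 \<le> - ?G'"
    using dual_val_strongly_convex[OF cert saddle_certified[OF r(1)], of r]
    unfolding dual_gap_def p_def q_def xs_def ys_def c_def
    by (simp add: norm_minus_commute)
  from mult_left_mono[OF this, of "\<alpha>"]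
  have cs: "\<alpha> * (p \<bullet> (c - \<omega>f')) + \<alpha> * (q \<bullet> (ys - yf')) + \<alpha> / (2 * l) * (norm (\<omega>f' - c))\<^sup>2
      + \<alpha> * r / 2 * (norm (yf' - ys))\<^sup>2 \<le> - \<alpha> * ?G'"
    using \<alpha> by (simp add: distrib_left)
  have rel': "p \<bullet> (\<omega>f' - \<omega>g) + q \<bullet> (yf' - yg) + 4 / l * (norm q)\<^sup>2 + l / 2 * (norm p)\<^sup>2 \<le> 0"
    using rel unfolding p_def[symmetric] q_def[symmetric] by (simp add: field_simps)
  have pp: "\<alpha> * l / 2 * (norm p)\<^sup>2 \<le> l / 2 * (norm p)\<^sup>2"
    using \<alpha> l by (intro mult_right_mono) auto
  \<comment> \<open>The gap shrinks by 1 - \<alpha> and the \<omega> distance by 1/2, while the y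
    distance shrinks by exactly 1 - \<alpha>/2 and sets the rate. These two terms are the slack of
    the others.\<close>
  have "0 \<le> \<alpha> / 2 * ?G" and "0 \<le> (1 - \<alpha>) * \<alpha> / (2 * l) * (norm (\<omega> - c))\<^sup>2"
  proof -
    have "0 \<le> (norm (\<omega>f + l *\<^sub>R saddle_x z r))\<^sup>2 / (2 * l) + r / 2 * (norm (yf - saddle_y z r))\<^sup>2"
      using r l by simp
    then show "0 \<le> \<alpha> / 2 * ?G" using dual_gap_lower[OF r(1) cert0] \<alpha> by simp
  qed (use \<alpha> l in auto)
  then have "?G' + \<alpha> / l * (norm (\<omega>' - c))\<^sup>2 + r * (norm (y' - ys))\<^sup>2
    \<le> (1 - \<alpha> / 2) * ?G + (1 - \<alpha> / 2) * (\<alpha> / l * (norm (\<omega> - c))\<^sup>2)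
        + (1 - \<alpha> / 2) * (r * (norm (y - ys))\<^sup>2)"
    using bx byy ex ey c0 cs rel' pp by (simp add: algebra_simps diff_divide_distrib add_divide_distrib)
  also have "\<dots> = (1 - \<alpha> / 2) * (?G + \<alpha> / l * (norm (\<omega> - c))\<^sup>2 + r * (norm (y - ys))\<^sup>2)"
    by (simp only: distrib_left)
  also have "\<dots> \<le> (1 - \<alpha> / 2) * e" using e \<alpha> unfolding os by (intro mult_left_mono) auto
  finally have "foam_err z r (\<omega>', y', \<omega>f', yf') ((1 - alpha r / 2) * e)"
    using cert unfolding foam_err_def prod.case xs_def[symmetric] ys_def[symmetric] \<alpha>_def[symmetric] os
    by blast
  then show ?thesis using step run(2) by blast
qed

lemma foam_run:
  assumes r: "0 < r" "r \<le> l / 8" and S: "foam_err z r S e" and \<rho>: "0 < \<rho>" "\<rho> < 1"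
  shows "\<exists>S' k. foam (saddle_oracle X Y f g) X Y l z r S \<rho> = Some (S', k) \<and>
    k \<le> nat \<lceil>2 / alpha r * ln (1 / \<rho>)\<rceil> * (prox_budget + 2) \<and> foam_err z r S' (\<rho> * e)"
proof -
  define n where "n = nat \<lceil>2 / alpha r * ln (1 / \<rho>)\<rceil>"
  have \<alpha>: "0 < alpha r" "alpha r \<le> 1" using alpha[OF r] by auto
  have "\<exists>S' k. run_iter n (foam_step (saddle_oracle X Y f g) X Y l z r) S = Some (S', k) \<and>
      k \<le> n * (prox_budget + 2) \<and> foam_err z r S' ((1 - alpha r / 2) ^ (0 + n) * e)"
    using foam_step_run[OF r] S
    by (intro run_iter_invariant[where P = "\<lambda>i S. foam_err z r S ((1 - alpha r / 2) ^ i * e)"])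
      (auto simp: mult.assoc)
  moreover have "(1 - alpha r / 2) ^ n \<le> \<rho>"
  proof -
    have "2 / alpha r * ln (1 / \<rho>) \<le> n" unfolding n_def by linarith
    then have n: "ln (1 / \<rho>) \<le> n * (alpha r / 2)" using \<alpha> by (simp add: field_simps)
    have "(1 - alpha r / 2) ^ n \<le> exp (- (alpha r / 2)) ^ n"
      using \<alpha> exp_ge_add_one_self[of "- (alpha r / 2)"] by (intro power_mono) auto
    also have "\<dots> = exp (- (n * (alpha r / 2)))" by (simp add: exp_of_nat_mult[symmetric])
    also have "\<dots> \<le> exp (ln \<rho>)" unfolding exp_le_cancel_iff using n \<rho> by (simp add: ln_div)
    finally show ?thesis using \<rho> by simp
  qed
  then have "(1 - alpha r / 2) ^ n * e \<le> \<rho> * e"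
    using foam_err_nonneg[OF r(1) S] by (rule mult_right_mono)
  ultimately show ?thesis
    unfolding foam_def alpha_def[symmetric] n_def[symmetric] by (auto intro: foam_err_mono)
qed

end

section \<open>Change of the proximal centre and of the regularisation\<close>

lemma norm2_diff_le: "(norm (a - b))\<^sup>2 \<le> 2 * (norm a)\<^sup>2 + 2 * (norm (b :: 'a::real_inner))\<^sup>2"
  using zero_le_power2[of "norm (a + b)"] unfolding power2_norm_eq_inner
  by (simp add: inner_simps inner_commute)

lemma norm2_diff_le':
  "(norm (a - b))\<^sup>2 \<le> 3 / 2 * (norm a)\<^sup>2 + 3 * (norm (b :: 'a::real_inner))\<^sup>2"
  using zero_le_power2[of "norm (a + 2 *\<^sub>R b)"] unfolding power2_norm_eq_inner
  by (simp add: inner_simps inner_commute)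

context smooth_saddle
begin

text \<open>\<open>hx\<close> contains the centre only in the summand - 2 l z, so moving \<omega> by
  - 2 l d compensates. Hence the algorithm applies this shift to \<open>\<omega>\<close> and
  \<open>\<omega>f\<close>.\<close>

lemma certified_shift:
  assumes "certified z x y \<omega> w"
  shows "certified (z + d) x y (\<omega> - (2 * l) *\<^sub>R d) w"
proof -
  have eq: "\<omega> - (2 * l) *\<^sub>R d - hx (z + d) x y = \<omega> - hx z x y"
    by (simp add: hx_def grad_x_Fhat_def algebra_simps)
  show ?thesis using assms unfolding certified_def eq .
qed

text \<open>The terms in x cancel: moving the centre perturbs the dual function by an affine
  function of \<omega> alone.\<close>

lemma dual_val_shift:
  "dual_val (z + d) r x y (\<omega> - (2 * l) *\<^sub>R d) =
    dual_val z r x y \<omega> - 2 * (\<omega> \<bullet> d) + (l * (norm d)\<^sup>2 - 2 * l * (z \<bullet> d))"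
proof -
  have "(norm (\<omega> - (2 * l) *\<^sub>R d))\<^sup>2 / (2 * l)
      = (norm \<omega>)\<^sup>2 / (2 * l) - 2 * (\<omega> \<bullet> d) + 2 * (l * (norm d)\<^sup>2)"
    unfolding power2_norm_eq_inner using l by (simp add: inner_simps inner_commute field_simps)
  moreover have "l * (norm (x - (z + d)))\<^sup>2
      = l * (norm (x - z))\<^sup>2 - 2 * l * (x \<bullet> d) + 2 * l * (z \<bullet> d) + l * (norm d)\<^sup>2"
    unfolding power2_norm_eq_inner by (simp add: inner_simps inner_commute algebra_simps)
  ultimately show ?thesis
    unfolding dual_val_def Fhat_def by (simp add: inner_diff_right)
qed

lemma two_inner_le: "2 * (v \<bullet> d) \<le> (norm v)\<^sup>2 / (2 * l) + 2 * (l * (norm (d :: 'c::real_inner))\<^sup>2)"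
proof -
  have "0 \<le> (norm (v - (2 * l) *\<^sub>R d))\<^sup>2 / (2 * l)" using l by simp
  also have "\<dots> = (norm v)\<^sup>2 / (2 * l) - 2 * (v \<bullet> d) + 2 * (l * (norm d)\<^sup>2)"
    unfolding power2_norm_eq_inner using l by (simp add: inner_simps inner_commute field_simps)
  finally show ?thesis by simp
qed

text \<open>In shifted coordinates the new problem is the old one plus a linear term, so strong
  convexity bounds the movement of the minimiser by a multiple of \<open>d\<close>. Each part of the
  potential is then re-centred at the new minimiser.\<close>

lemma foam_err_shift:
  assumes r: "0 < r" "r \<le> l / 8" and S: "foam_err z r (\<omega>, y, \<omega>f, yf) e"
  shows "foam_err (z + d) r (\<omega> - (2 * l) *\<^sub>R d, y, \<omega>f - (2 * l) *\<^sub>R d, yf) (2 * e + 24 * (l * (norm d)\<^sup>2))"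
proof -
  have \<alpha>: "0 < alpha r" "alpha r \<le> 1" using alpha[OF r] by auto
  define xs ys xs' ys' where "xs = saddle_x z r" "ys = saddle_y z r"
    "xs' = saddle_x (z + d) r" "ys' = saddle_y (z + d) r"
  define o1 o2 where "o1 = - l *\<^sub>R xs" and "o2 = - l *\<^sub>R xs' + (2 * l) *\<^sub>R d"
  define v where "v = o2 - o1"
  define Q where "Q = l * (norm d)\<^sup>2"
  obtain xf wf where cert: "certified z xf yf \<omega>f wf"
    and e: "dual_gap z r xf yf \<omega>f + alpha r / l * (norm (\<omega> - o1))\<^sup>2 + r * (norm (y - ys))\<^sup>2 \<le> e"
    using S unfolding foam_err_def o1_def xs_ys_xs'_ys'_def by auto
  have cert1: "certified z xs ys o1 (- r *\<^sub>R ys)"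
    using saddle_certified[OF r(1)] by (simp add: o1_def xs_ys_xs'_ys'_def)
  have cert2: "certified z xs' ys' o2 (- r *\<^sub>R ys')"
    using certified_shift[OF saddle_certified[OF r(1), of "z + d"], of "- d"]
    by (simp add: o2_def xs_ys_xs'_ys'_def)
  have o2': "- l *\<^sub>R xs' = o2 - (2 * l) *\<^sub>R d" by (simp add: o2_def)
  define A where "A = dual_gap z r xs' ys' o2"
  have A: "(norm v)\<^sup>2 / (2 * l) + r / 2 * (norm (ys' - ys))\<^sup>2 \<le> A"
    using dual_gap_lower[OF r(1) cert2] unfolding A_def v_def o1_def xs_ys_xs'_ys'_def by simp
  have gap_shift: "dual_gap (z + d) r x y (\<omega> - (2 * l) *\<^sub>R d)
      = dual_gap z r x y \<omega> - A - 2 * ((\<omega> - o2) \<bullet> d)" for x y \<omega>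
    unfolding dual_gap_def A_def xs_ys_xs'_ys'_def(3,4)[symmetric] o2' dual_val_shift
    by (simp add: inner_diff_left)
  \<comment> \<open>Each minimiser is tested in the problem of the other; the two gaps add up to the
    linear perturbation \<open>2 * (v \<bullet> d)\<close>.\<close>
  have "(norm v)\<^sup>2 / (2 * l) + r / 2 * (norm (ys' - ys))\<^sup>2
      \<le> dual_gap (z + d) r xs ys (o1 - (2 * l) *\<^sub>R d)"
    using dual_gap_lower[OF r(1) certified_shift[OF cert1, of d]]
    unfolding v_def o2_def xs_ys_xs'_ys'_def(3,4)[symmetric]
    by (simp add: norm_minus_commute algebra_simps)
  also have "\<dots> = 2 * (v \<bullet> d) - A"
    unfolding gap_shift by (simp add: dual_gap_def o1_def xs_ys_xs'_ys'_def v_def inner_simps)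
  finally have sum: "2 * ((norm v)\<^sup>2 / (2 * l)) + r * (norm (ys' - ys))\<^sup>2 \<le> 2 * (v \<bullet> d)"
    using A by simp
  have vd: "2 * (v \<bullet> d) \<le> (norm v)\<^sup>2 / (2 * l) + 2 * Q" unfolding Q_def by (rule two_inner_le)
  have r0: "0 \<le> r * (norm (ys' - ys))\<^sup>2" and Q: "0 \<le> Q" using r l by (auto simp: Q_def)
  have "- (2 * ((\<omega>f - o1) \<bullet> d)) \<le> (norm (\<omega>f - o1))\<^sup>2 / (2 * l) + 2 * Q"
    using two_inner_le[of "o1 - \<omega>f" d] by (simp add: Q_def norm_minus_commute inner_diff_left)
  moreover have "(norm (\<omega>f - o1))\<^sup>2 / (2 * l) \<le> dual_gap z r xf yf \<omega>f"
  proof -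
    have "0 \<le> r / 2 * (norm (yf - saddle_y z r))\<^sup>2" using r by simp
    then show ?thesis
      using dual_gap_lower[OF r(1) cert] unfolding o1_def xs_ys_xs'_ys'_def by simp
  qed
  moreover have "(\<omega>f - o2) \<bullet> d = (\<omega>f - o1) \<bullet> d - v \<bullet> d" by (simp add: v_def inner_diff_left)
  ultimately have gap': "dual_gap (z + d) r xf yf (\<omega>f - (2 * l) *\<^sub>R d) \<le> 2 * dual_gap z r xf yf \<omega>f + 4 * Q"
    unfolding gap_shift using A vd r0 by simp
  have "alpha r / l * (norm (\<omega> - o2))\<^sup>2 \<le> alpha r / l * (2 * (norm (\<omega> - o1))\<^sup>2 + 2 * (norm v)\<^sup>2)"
    using norm2_diff_le[of "\<omega> - o1" v] \<alpha> l by (intro mult_left_mono) (auto simp: v_def)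
  also have "\<dots> \<le> 2 * (alpha r / l * (norm (\<omega> - o1))\<^sup>2) + 4 * ((norm v)\<^sup>2 / (2 * l))"
    using mult_right_mono[OF \<alpha>(2), of "(norm v)\<^sup>2"] l by (simp add: field_simps)
  finally have w: "alpha r / l * (norm (\<omega> - o2))\<^sup>2
    \<le> 2 * (alpha r / l * (norm (\<omega> - o1))\<^sup>2) + 4 * ((norm v)\<^sup>2 / (2 * l))" .
  have "r * (norm (y - ys'))\<^sup>2 \<le> r * (2 * (norm (y - ys))\<^sup>2 + 2 * (norm (ys' - ys))\<^sup>2)"
    using norm2_diff_le[of "y - ys" "ys' - ys"] r by (intro mult_left_mono) auto
  \<comment> \<open>The gap adds \<open>4 * Q\<close> and the two distances at most
    \<open>8 * Q\<close>, so 24 leaves room.\<close>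
  then have "dual_gap (z + d) r xf yf (\<omega>f - (2 * l) *\<^sub>R d) + alpha r / l * (norm (\<omega> - o2))\<^sup>2
      + r * (norm (y - ys'))\<^sup>2 \<le> 2 * e + 24 * Q"
    using gap' w sum vd r0 Q e unfolding distrib_left by linarith
  moreover have "\<omega> - o2 = \<omega> - (2 * l) *\<^sub>R d + l *\<^sub>R xs'" by (simp add: o2_def)
  ultimately show ?thesis
    unfolding foam_err_def prod.case xs_ys_xs'_ys'_def(3,4)[symmetric] Q_def[symmetric]
    using certified_shift[OF cert] by auto
qed

text \<open>Quartering \<open>r\<close> halves \<alpha>, so the weights shrink enough to absorb the
  factor 2 of re-centring and the old error is not amplified. The new part comes from the 3/8 r
  |y|^2 by which the objectives differ.\<close>

lemma foam_err_next_level: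
  assumes r: "0 < r" "r \<le> l / 8" and S: "foam_err z r S e"
  shows "foam_err z (r / 4) S (e + 9 / 16 * (r * D\<^sup>2))"
proof -
  have r': "0 < r / 4" using r by simp
  have \<alpha>: "0 < alpha r" "alpha r \<le> 1" using alpha[OF r] by auto
  have \<alpha>': "alpha (r / 4) = alpha r / 2"
  proof -
    have "alpha (r / 4) = sqrt ((8 * r / l) / 4)" by (simp add: alpha_def)
    then show ?thesis by (simp only: alpha_def real_sqrt_divide real_sqrt_four)
  qed
  obtain \<omega> y \<omega>f yf where S_eq: "S = (\<omega>, y, \<omega>f, yf)" by (cases S)
  define xs ys xs' ys' where "xs = saddle_x z r" "ys = saddle_y z r"
    "xs' = saddle_x z (r / 4)" "ys' = saddle_y z (r / 4)"
  define o1 o2 where "o1 = - l *\<^sub>R xs" and "o2 = - l *\<^sub>R xs'"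
  define v where "v = o2 - o1"
  obtain xf wf where cert: "certified z xf yf \<omega>f wf"
    and e: "dual_gap z r xf yf \<omega>f + alpha r / l * (norm (\<omega> - o1))\<^sup>2 + r * (norm (y - ys))\<^sup>2 \<le> e"
    using S unfolding foam_err_def o1_def xs_ys_xs'_ys'_def S_eq by auto
  have cert1: "certified z xs ys o1 (- r *\<^sub>R ys)"
    using saddle_certified[OF r(1)] by (simp add: o1_def xs_ys_xs'_ys'_def)
  have cert2: "certified z xs' ys' o2 (- (r / 4) *\<^sub>R ys')"
    using saddle_certified[OF r'] by (simp add: o2_def xs_ys_xs'_ys'_def)
  define A where "A = dual_gap z r xs' ys' o2"
  have A: "(norm v)\<^sup>2 / (2 * l) + r / 2 * (norm (ys' - ys))\<^sup>2 \<le> A"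
    using dual_gap_lower[OF r(1) cert2] unfolding A_def v_def o1_def xs_ys_xs'_ys'_def by simp
  have gap_level: "dual_gap z (r / 4) x y \<omega>
      = dual_gap z r x y \<omega> - A + 3 / 8 * (r * (norm ys')\<^sup>2) - 3 / 8 * (r * (norm y)\<^sup>2)" for x y \<omega>
    unfolding dual_gap_def A_def xs_ys_xs'_ys'_def(3,4)[symmetric] o2_def[symmetric] dual_val_def
    by (simp add: algebra_simps)
  have rD: "r * (norm ys')\<^sup>2 \<le> r * D\<^sup>2"
    using norm2_Y[OF saddle_in(2)[OF r']] r by (intro mult_left_mono) (auto simp: xs_ys_xs'_ys'_def)
  have "(norm v)\<^sup>2 / (2 * l) + r / 4 / 2 * (norm (ys - ys'))\<^sup>2 \<le> dual_gap z (r / 4) xs ys o1"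
    using dual_gap_lower[OF r' cert1] unfolding v_def o2_def xs_ys_xs'_ys'_def(3,4)[symmetric]
    by (simp add: norm_minus_commute)
  moreover have "dual_gap z r xs ys o1 = 0"
    by (simp add: dual_gap_def o1_def xs_ys_xs'_ys'_def)
  moreover have nonneg: "0 \<le> r * (norm (ys - ys'))\<^sup>2" "0 \<le> r * (norm (ys' - ys))\<^sup>2" "0 \<le> r * (norm ys)\<^sup>2" "0 \<le> r * (norm yf)\<^sup>2"
    using r by auto
  ultimately have v: "2 * ((norm v)\<^sup>2 / (2 * l)) \<le> 3 / 8 * (r * D\<^sup>2)"
    using A rD unfolding gap_level by linarith
  have "alpha r / 2 / l * (norm (\<omega> - o2))\<^sup>2 \<le> alpha r / 2 / l * (2 * (norm (\<omega> - o1))\<^sup>2 + 2 * (norm v)\<^sup>2)"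
    using norm2_diff_le[of "\<omega> - o1" v] \<alpha> l by (intro mult_left_mono) (auto simp: v_def)
  also have "\<dots> \<le> alpha r / l * (norm (\<omega> - o1))\<^sup>2 + 2 * ((norm v)\<^sup>2 / (2 * l))"
    using mult_right_mono[OF \<alpha>(2), of "(norm v)\<^sup>2"] l by (simp add: field_simps)
  finally have w: "alpha r / 2 / l * (norm (\<omega> - o2))\<^sup>2
    \<le> alpha r / l * (norm (\<omega> - o1))\<^sup>2 + 2 * ((norm v)\<^sup>2 / (2 * l))" .
  have yy: "r / 4 * (norm (y - ys'))\<^sup>2 \<le> r / 4 * (2 * (norm (y - ys))\<^sup>2 + 2 * (norm (ys' - ys))\<^sup>2)"
    using norm2_diff_le[of "y - ys" "ys' - ys"] r by (intro mult_left_mono) auto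
  have "0 \<le> r * (norm (y - ys))\<^sup>2" using r by simp
  \<comment> \<open>\<open>A\<close> absorbs the y displacement and half of the \<omega>
    displacement. What remains is 3/8 + 3/16 = 9/16 of \<open>r * D\<^sup>2\<close>.\<close>
  then have "dual_gap z (r / 4) xf yf \<omega>f + alpha r / 2 / l * (norm (\<omega> - o2))\<^sup>2
      + r / 4 * (norm (y - ys'))\<^sup>2 \<le> e + 9 / 16 * (r * D\<^sup>2)"
    unfolding gap_level using w v e A rD nonneg yy by (simp add: distrib_left)
  then show ?thesis
    unfolding foam_err_def S_eq prod.case xs_ys_xs'_ys'_def(3,4)[symmetric] \<alpha>'
    using cert by (auto simp: o2_def)
qed

section \<open>The primal function and the regularised saddle value\<close>

definition \<Phi> :: "'a \<Rightarrow> real" where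
  "\<Phi> x = (SUP y\<in>Y. f (x, y))"

text \<open>The supergradient at 0 provides the bound, so \<open>Y\<close> need only be
  bounded.\<close>

lemma bdd_above_f: "x \<in> X \<Longrightarrow> bdd_above ((\<lambda>y. f (x, y)) ` Y)"
proof (rule bdd_aboveI2)
  fix y assume xy: "x \<in> X" "y \<in> Y"
  have "f (x, y) \<le> f (x, 0) + gx' \<bullet> y" if "gx' = gy x 0" for gx'
    using concave_gradient[OF xy(1) Y(3) xy(2)] that by simp
  also have "gy x 0 \<bullet> y \<le> norm (gy x 0) * D"
    using norm_Y[OF xy(2)] by (intro order_trans[OF norm_cauchy_schwarz] mult_left_mono) auto
  finally show "f (x, y) \<le> f (x, 0) + norm (gy x 0) * D" by simp
qed

lemma f_le_\<Phi>: "x \<in> X \<Longrightarrow> y \<in> Y \<Longrightarrow> f (x, y) \<le> \<Phi> x"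
  unfolding \<Phi>_def by (rule cSUP_upper[OF _ bdd_above_f])

lemma \<Phi>_least: "(\<And>y. y \<in> Y \<Longrightarrow> f (x, y) \<le> c) \<Longrightarrow> \<Phi> x \<le> c"
  unfolding \<Phi>_def using Y(3) by (intro cSUP_least) auto

text \<open>The certificate at - l x restores the term l/2 |x|^2 missing in \<open>Fhat\<close>, and
  that term supplies the quadratic growth.\<close>

lemma saddle_min_x:
  assumes r: "r > 0" and x: "x \<in> X"
  shows "f (saddle_x z r, saddle_y z r) + l * (norm (saddle_x z r - z))\<^sup>2
      + l / 2 * (norm (x - saddle_x z r))\<^sup>2 \<le> f (x, saddle_y z r) + l * (norm (x - z))\<^sup>2"
proof -
  let ?x = "saddle_x z r" and ?y = "saddle_y z r"
  have "Fhat z ?x ?y + hx z ?x ?y \<bullet> (x - ?x) \<le> Fhat z x ?y"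
    using saddle_in[OF r] x by (intro Fhat_convex_x)
  moreover have "(- l *\<^sub>R ?x - hx z ?x ?y) \<bullet> (x - ?x) \<le> 0"
    using saddle_certified[OF r] x unfolding certified_def by blast
  then have "- (l * (?x \<bullet> (x - ?x))) \<le> hx z ?x ?y \<bullet> (x - ?x)" by (simp add: inner_diff_left)
  moreover have "l / 2 * (norm x)\<^sup>2 = l / 2 * (norm ?x)\<^sup>2 + l * (?x \<bullet> (x - ?x)) + l / 2 * (norm (x - ?x))\<^sup>2"
    unfolding power2_norm_eq_inner by (simp add: inner_simps inner_commute algebra_simps)
  ultimately show ?thesis unfolding Fhat_def by linarith
qed

lemma saddle_max_y:
  assumes r: "r > 0" and y: "y \<in> Y"
  shows "f (saddle_x z r, y) - r / 2 * (norm y)\<^sup>2 + r / 2 * (norm (y - saddle_y z r))\<^sup>2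
    \<le> f (saddle_x z r, saddle_y z r) - r / 2 * (norm (saddle_y z r))\<^sup>2"
proof -
  let ?x = "saddle_x z r" and ?y = "saddle_y z r"
  have "f (?x, y) \<le> f (?x, ?y) + gy ?x ?y \<bullet> (y - ?y)"
    using saddle_in[OF r] y by (intro concave_gradient)
  moreover have "(- r *\<^sub>R ?y + gy ?x ?y) \<bullet> (y - ?y) \<le> 0"
    using saddle_certified[OF r] y unfolding certified_def by blast
  then have "gy ?x ?y \<bullet> (y - ?y) \<le> r * (?y \<bullet> (y - ?y))"
    by (simp add: inner_diff_left)
  moreover have "r / 2 * (norm y)\<^sup>2 = r / 2 * (norm ?y)\<^sup>2 + r * (?y \<bullet> (y - ?y)) + r / 2 * (norm (y - ?y))\<^sup>2"
    unfolding power2_norm_eq_inner by (simp add: inner_simps inner_commute algebra_simps)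
  ultimately show ?thesis by linarith
qed

text \<open>A regularised stand-in for the Moreau envelope at \<open>z\<close>, used to measure the
  progress of the outer loop.\<close>

definition saddle_val :: "'a \<Rightarrow> real \<Rightarrow> real" where
  "saddle_val z r = f (saddle_x z r, saddle_y z r) + l * (norm (saddle_x z r - z))\<^sup>2
     - r / 2 * (norm (saddle_y z r))\<^sup>2"

lemma saddle_val_upper:
  assumes "r > 0" "z \<in> X"
  shows "saddle_val z r + l / 2 * (norm (z - saddle_x z r))\<^sup>2 \<le> \<Phi> z"
proof -
  have "0 \<le> r / 2 * (norm (saddle_y z r))\<^sup>2" using assms by simp
  then show ?thesis
    using saddle_min_x[OF assms, of z] f_le_\<Phi>[OF assms(2) saddle_in(2)[OF assms(1)], of z]
    by (simp add: saddle_val_def)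
qed

lemma saddle_val_lower:
  assumes "r > 0"
  shows "\<Phi> (saddle_x z r) + l * (norm (saddle_x z r - z))\<^sup>2 - r / 2 * D\<^sup>2 \<le> saddle_val z r"
proof -
  have "\<Phi> (saddle_x z r) \<le> saddle_val z r - l * (norm (saddle_x z r - z))\<^sup>2 + r / 2 * D\<^sup>2"
  proof (rule \<Phi>_least)
    fix y assume y: "y \<in> Y"
    have "r / 2 * (norm y)\<^sup>2 \<le> r / 2 * D\<^sup>2" "0 \<le> r / 2 * (norm (y - saddle_y z r))\<^sup>2"
      using norm2_Y[OF y] assms by auto
    then show "f (saddle_x z r, y) \<le> saddle_val z r - l * (norm (saddle_x z r - z))\<^sup>2 + r / 2 * D\<^sup>2"
      using saddle_max_y[OF assms y, of z] unfolding saddle_val_def by linarith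
  qed
  then show ?thesis by simp
qed

text \<open>Strong convexity places - \<omega>f / l within sqrt (2 e / l) of the saddle point's x,
  and projecting onto \<open>X\<close> brings it no farther away. So each outer step is an inexact
  proximal point step.\<close>

lemma outer_step:
  assumes r: "r > 0" and S: "foam_err z r (\<omega>, y, \<omega>f, yf) e" and z': "z' = proj X (- (1 / l) *\<^sub>R \<omega>f)"
  shows "saddle_val z' r + l * (norm (z' - z))\<^sup>2 / 2 \<le> saddle_val z r + 4 * e"
    and "l * (norm (z - saddle_x z r))\<^sup>2 \<le> 3 * (l * (norm (z' - z))\<^sup>2 + e)"
proof -
  let ?x = "saddle_x z r" and ?y = "saddle_y z r"
  have ne: "X \<noteq> {}" using X by auto
  obtain xf wf where cert: "certified z xf yf \<omega>f wf"
    and e: "dual_gap z r xf yf \<omega>f + alpha r / l * (norm (\<omega> + l *\<^sub>R ?x))\<^sup>2 + r * (norm (y - ?y))\<^sup>2 \<le> e"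
    using S unfolding foam_err_def by auto
  have "0 \<le> alpha r / l * (norm (\<omega> + l *\<^sub>R ?x))\<^sup>2" "0 \<le> r * (norm (y - ?y))\<^sup>2"
    "0 \<le> r / 2 * (norm (yf - ?y))\<^sup>2"
    using r l by (auto simp: alpha_def)
  then have gap_e: "(norm (\<omega>f + l *\<^sub>R ?x))\<^sup>2 / (2 * l) \<le> e"
    using dual_gap_lower[OF r cert] e by linarith
  have "norm (z' - ?x) \<le> norm (- (1 / l) *\<^sub>R \<omega>f - ?x)"
    unfolding z' by (rule proj_dist_le[OF X(1,2) ne saddle_in(1)[OF r]])
  also have "- (1 / l) *\<^sub>R \<omega>f - ?x = - (1 / l) *\<^sub>R (\<omega>f + l *\<^sub>R ?x)"
    using l by (simp add: algebra_simps)
  also have "norm \<dots> = norm (\<omega>f + l *\<^sub>R ?x) / l" using l unfolding norm_scaleR by simp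
  finally have "l * (norm (z' - ?x))\<^sup>2 \<le> l * (norm (\<omega>f + l *\<^sub>R ?x) / l)\<^sup>2"
    using l by (intro mult_left_mono power_mono) auto
  also have "\<dots> = 2 * ((norm (\<omega>f + l *\<^sub>R ?x))\<^sup>2 / (2 * l))"
    using l by (simp add: power2_eq_square)
  also have "\<dots> \<le> 2 * e" using gap_e by simp
  finally have err: "l * (norm (z' - ?x))\<^sup>2 \<le> 2 * e" .
  \<comment> \<open>The old x competes in the minimisation at \<open>z'\<close>, and the new y in
    the maximisation at \<open>z\<close>.\<close>
  have "saddle_val z' r \<le> saddle_val z r - l * (norm (?x - z))\<^sup>2 + l * (norm (z' - ?x))\<^sup>2"
  proof -
    have "0 \<le> l / 2 * (norm (?x - saddle_x z' r))\<^sup>2" "0 \<le> r / 2 * (norm (saddle_y z' r - ?y))\<^sup>2"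
      using l r by auto
    then show ?thesis
      using saddle_min_x[OF r saddle_in(1)[OF r], of z' z] saddle_max_y[OF r saddle_in(2)[OF r], of z z']
      unfolding saddle_val_def by (simp add: norm_minus_commute)
  qed
  moreover have "l * (norm (z' - z))\<^sup>2 \<le> l * (2 * (norm (z' - ?x))\<^sup>2 + 2 * (norm (?x - z))\<^sup>2)"
    using norm2_diff_le[of "z' - ?x" "z - ?x"] l
    by (intro mult_left_mono) (auto simp: norm_minus_commute)
  ultimately show "saddle_val z' r + l * (norm (z' - z))\<^sup>2 / 2 \<le> saddle_val z r + 4 * e"
    using err by (simp add: algebra_simps)
  have "(norm (z - ?x))\<^sup>2 \<le> 3 * (norm (z' - z))\<^sup>2 + 3 / 2 * (norm (z' - ?x))\<^sup>2"
    using norm2_diff_le'[of "z' - ?x" "z' - z"] by (simp add: norm_minus_commute)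
  then have "l * (norm (z - ?x))\<^sup>2 \<le> l * (3 * (norm (z' - z))\<^sup>2 + 3 / 2 * (norm (z' - ?x))\<^sup>2)"
    using l by (intro mult_left_mono) auto
  then show "l * (norm (z - ?x))\<^sup>2 \<le> 3 * (l * (norm (z' - z))\<^sup>2 + e)"
    using err by (simp add: algebra_simps)
qed

end

section \<open>The outer loop\<close>

locale smooth_saddle_gap = smooth_saddle X Y f g l D
  for X :: "'a::real_inner set" and Y :: "'b::real_inner set" and f g l D +
  fixes \<Delta> :: real
  assumes gap: "\<And>x. x \<in> X \<Longrightarrow> \<Phi> 0 - \<Phi> x \<le> \<Delta>"
begin

abbreviation "orc \<equiv> saddle_oracle X Y f g"

lemma \<Delta>_nonneg: "0 \<le> \<Delta>"
  using gap[OF X(3)] by simp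

text \<open>At the coarsest level \<alpha> = 1 and both copies of the dual point coincide, so the
  distances are at most twice the gap. With zero input the relative error inequality bounds the gap
  by the norm of the saddle point.\<close>

lemma init_run:
  "\<exists>S k. tf_init orc X Y l 0 = Some (S, k) \<and> k \<le> prox_budget + 2 \<and>
    foam_err 0 (l / 8) S (\<Delta> + 2 * (l / 8 * D\<^sup>2))"
proof -
  define r where "r = l / 8"
  have r: "0 < r" "r \<le> l / 8" using l by (auto simp: r_def)
  have \<alpha>: "alpha r = 1" using l by (simp add: alpha_def r_def)
  obtain xf yf \<omega>f wf k where run:
    "rel_prox orc X Y l 0 r (0, 0) = Some ((xf, yf, \<omega>f, wf), k)"
    "k \<le> prox_budget + 2" and cert: "certified 0 xf yf \<omega>f wf" and rel:
    "2 * ((xf + (1 / l) *\<^sub>R \<omega>f) \<bullet> (\<omega>f - 0)) + 2 * ((wf + r *\<^sub>R yf) \<bullet> (yf - 0))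
      + (8 / l) * (norm (wf + r *\<^sub>R yf))\<^sup>2 + l * (norm (xf + (1 / l) *\<^sub>R \<omega>f))\<^sup>2 \<le> 0"
    using rel_prox_run[OF r] by metis
  define p q where "p = xf + (1 / l) *\<^sub>R \<omega>f" and "q = wf + r *\<^sub>R yf"
  define xs ys where "xs = saddle_x 0 r" and "ys = saddle_y 0 r"
  define G where "G = dual_gap 0 r xf yf \<omega>f"
  have tf: "tf_init orc X Y l 0 = Some ((\<omega>f, yf, \<omega>f, yf), k)"
    using run(1) by (simp add: run_bind_def run_return_def r_def)
  have low: "(norm (\<omega>f + l *\<^sub>R xs))\<^sup>2 / (2 * l) + r / 2 * (norm (yf - ys))\<^sup>2 \<le> G"
    unfolding G_def xs_def ys_def by (rule dual_gap_lower[OF r(1) cert])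
  have "G + p \<bullet> (- l *\<^sub>R xs - \<omega>f) + q \<bullet> (ys - yf) \<le> 0"
  proof -
    have "0 \<le> (norm (- l *\<^sub>R xs - \<omega>f))\<^sup>2 / (2 * l) + r / 2 * (norm (ys - yf))\<^sup>2" using l r by simp
    then show ?thesis
      using dual_val_strongly_convex[OF cert saddle_certified[OF r(1)], of r]
      unfolding G_def dual_gap_def p_def q_def xs_def ys_def by linarith
  qed
  moreover have "p \<bullet> \<omega>f + q \<bullet> yf + 4 / l * (norm q)\<^sup>2 + l / 2 * (norm p)\<^sup>2 \<le> 0"
    using rel unfolding p_def[symmetric] q_def[symmetric] by (simp add: field_simps)
  moreover have "l * (p \<bullet> xs) \<le> l / 2 * (norm p)\<^sup>2 + l / 2 * (norm xs)\<^sup>2"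
  proof -
    have "0 \<le> l / 2 * (norm (p - xs))\<^sup>2" using l by simp
    then show ?thesis
      unfolding power2_norm_eq_inner by (simp add: inner_simps inner_commute algebra_simps)
  qed
  moreover have "- (q \<bullet> ys) \<le> 4 / l * (norm q)\<^sup>2 + r / 2 * (norm ys)\<^sup>2"
  proof -
    have "0 \<le> 4 / l * (norm (q + r *\<^sub>R ys))\<^sup>2" using l by simp
    also have "\<dots> = 4 / l * (norm q)\<^sup>2 + q \<bullet> ys + r / 2 * (norm ys)\<^sup>2"
      unfolding power2_norm_eq_inner r_def using l
      by (simp add: inner_simps inner_commute field_simps)
    finally show ?thesis by simp
  qed
  ultimately have G: "G \<le> l / 2 * (norm xs)\<^sup>2 + r / 2 * (norm ys)\<^sup>2"
    by (simp add: inner_diff_right)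
  have "G + alpha r / l * (norm (\<omega>f + l *\<^sub>R xs))\<^sup>2 + r * (norm (yf - ys))\<^sup>2 \<le> 3 * G"
    using low by (simp add: \<alpha>)
  also have "\<dots> \<le> 3 / 2 * (l * (norm xs)\<^sup>2) + 3 / 2 * (r * (norm ys)\<^sup>2)" using G by simp
  \<comment> \<open>The two bounds on \<open>saddle_val\<close> at centre 0 carry weights l/2 and l
    of |xs|^2; chained, they give 3/2.\<close>
  also have "3 / 2 * (l * (norm xs)\<^sup>2) \<le> \<Delta> + r / 2 * D\<^sup>2"
    using saddle_val_upper[OF r(1) X(3)] saddle_val_lower[OF r(1), of 0] gap[OF saddle_in(1)[OF r(1), of 0]]
    unfolding xs_def by (simp add: norm_minus_commute)
  also have "r * (norm ys)\<^sup>2 \<le> r * D\<^sup>2"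
    using norm2_Y[OF saddle_in(2)[OF r(1)]] r unfolding ys_def by (intro mult_left_mono) auto
  finally have "foam_err 0 r (\<omega>f, yf, \<omega>f, yf) (\<Delta> + 2 * (r * D\<^sup>2))"
    using cert unfolding foam_err_def prod.case xs_def[symmetric] ys_def[symmetric] G_def
    by (auto simp: algebra_simps)
  with tf run(2) show ?thesis unfolding r_def by blast
qed

lemma ry_level: "0 < ry_level l j" "ry_level l j \<le> l / 8" "ry_level l (Suc j) = ry_level l j / 4"
  "alpha (ry_level l j) = (1 / 2) ^ j"
proof -
  have "(1 / 4 :: real) ^ j \<le> 1" by (rule power_le_one) auto
  from mult_right_mono[OF this, of "l / 8"] show "ry_level l j \<le> l / 8"
    using l by (simp add: ry_level_def)
  have "alpha (ry_level l j) = sqrt (((1 / 2) ^ j)\<^sup>2)"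
    using l by (simp add: alpha_def ry_level_def power2_eq_square flip: power_mult_distrib)
  then show "alpha (ry_level l j) = (1 / 2) ^ j" by simp
qed (use l in \<open>auto simp: ry_level_def\<close>)

text \<open>The crude bound ln t \<le> t - 1 suffices for a fixed \<open>\<rho>\<close>, and its - 1
  pays for rounding up. Only the factor \<open>2 ^ j\<close> matters.\<close>

lemma foam_calls:
  assumes "\<rho> > 0"
  shows "real (nat \<lceil>2 / (1 / 2) ^ j * ln (1 / \<rho>)\<rceil>) \<le> 2 ^ j * (2 / \<rho>)"
proof (cases "ln (1 / \<rho>) \<le> 0")
  case True
  then have "2 / (1 / 2) ^ j * ln (1 / \<rho>) \<le> 0" by (intro mult_nonneg_nonpos) auto
  then have "nat \<lceil>2 / (1 / 2) ^ j * ln (1 / \<rho>)\<rceil> = 0" by simp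
  then show ?thesis using assms by simp
next
  case False
  have "ln (1 / \<rho>) \<le> 1 / \<rho> - 1" using assms by (intro ln_le_minus_one) simp
  then have "2 * 2 ^ j * ln (1 / \<rho>) \<le> 2 * 2 ^ j * (1 / \<rho> - 1)" by (intro mult_left_mono) auto
  moreover have "2 * 2 ^ j * (1 / \<rho> - 1) + 1 \<le> 2 ^ j * (2 / \<rho>)"
  proof -
    have "2 * 2 ^ j * (1 / \<rho>) = 2 ^ j * (2 / \<rho>)" by simp
    then show ?thesis using two_realpow_ge_one[of j] unfolding right_diff_distrib by argo
  qed
  moreover have eq: "2 / (1 / 2) ^ j * ln (1 / \<rho>) = 2 * 2 ^ j * ln (1 / \<rho>)"
    by (simp add: power_one_over)
  moreover have "0 \<le> 2 * 2 ^ j * ln (1 / \<rho>)" using False by simp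
  then have "real (nat \<lceil>2 * 2 ^ j * ln (1 / \<rho>)\<rceil>) \<le> 2 * 2 ^ j * ln (1 / \<rho>) + 1" by linarith
  ultimately show ?thesis unfolding eq by linarith
qed

text \<open>Level j costs at most 16 * 2^j prox budgets, so the sum is geometric and the last level
  dominates. The reduction by 1/8 outweighs the change of level, since (8 + 9/4)/8 \<le> 2, and the
  error bound keeps its form.\<close>

lemma tf_init_run:
  "\<exists>S k. tf_init orc X Y l j = Some (S, k) \<and>
    real k \<le> 32 * 2 ^ j * real (prox_budget + 2) \<and>
    foam_err 0 (ry_level l j) S (\<Delta> + 2 * (ry_level l j * D\<^sup>2))"
proof (induction j)
  case 0
  then show ?case using init_run by (auto simp: ry_level_def)
next
  case (Suc j)
  let ?r = "ry_level l (Suc j)"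
  obtain S k where S: "tf_init orc X Y l j = Some (S, k)" "real k \<le> 32 * 2 ^ j * real (prox_budget + 2)"
    "foam_err 0 (ry_level l j) S (\<Delta> + 2 * (ry_level l j * D\<^sup>2))"
    using Suc by blast
  have err: "foam_err 0 ?r S (\<Delta> + 2 * (4 * ?r * D\<^sup>2) + 9 / 16 * (4 * ?r * D\<^sup>2))"
    using foam_err_next_level[OF ry_level(1,2) S(3)] unfolding ry_level(3) by simp
  obtain S' k' where S': "foam orc X Y l 0 ?r S (1 / 8) = Some (S', k')"
    "k' \<le> nat \<lceil>2 / alpha ?r * ln (1 / (1 / 8))\<rceil> * (prox_budget + 2)"
    "foam_err 0 ?r S' (1 / 8 * (\<Delta> + 2 * (4 * ?r * D\<^sup>2) + 9 / 16 * (4 * ?r * D\<^sup>2)))"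
    using foam_run[OF ry_level(1,2) err, of "1 / 8"] by auto
  have "real k' \<le> real (nat \<lceil>2 / (1 / 2) ^ Suc j * ln (1 / (1 / 8 :: real))\<rceil>) * real (prox_budget + 2)"
    using S'(2) unfolding ry_level(4) of_nat_mult[symmetric] of_nat_le_iff .
  also have "\<dots> \<le> 2 ^ Suc j * (2 / (1 / 8)) * real (prox_budget + 2)"
    by (intro mult_right_mono foam_calls) auto
  finally have k': "real k' \<le> 2 ^ Suc j * 16 * real (prox_budget + 2)" by simp
  have "real (k + k') \<le> 32 * 2 ^ Suc j * real (prox_budget + 2)"
    using S(2) k' by (simp add: algebra_simps)
  moreover have "foam_err 0 ?r S' (\<Delta> + 2 * (?r * D\<^sup>2))"
  proof (rule foam_err_mono[OF S'(3)])
    have "0 \<le> ?r * D\<^sup>2" using ry_level(1)[of "Suc j"] by simp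
    then show "1 / 8 * (\<Delta> + 2 * (4 * ?r * D\<^sup>2) + 9 / 16 * (4 * ?r * D\<^sup>2)) \<le> \<Delta> + 2 * (?r * D\<^sup>2)"
      using \<Delta>_nonneg by simp
  qed
  moreover have "tf_init orc X Y l (Suc j) = Some (S', k + k')"
    using S(1) S'(1) by (simp add: run_bind_def)
  ultimately show ?case by blast
qed

text \<open>
  The decrease of the Lyapunov function \<open>saddle_val + 403/100 e + 121/500 B\<close> in one outer iteration pays
  for \<open>6/25 Q\<close>; here \<open>e\<close> is the true error, while the algorithm only knows its upper bound \<open>B\<close>.
\<close>

definition outer_inv ::
  "real \<Rightarrow> real \<Rightarrow> nat \<Rightarrow> 'a \<times> ('a, 'b) foam_state \<times> real \<times> ('a \<times> real) list \<Rightarrow> bool" where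
  "outer_inv r K t = (\<lambda>(z, S, B, hist). z \<in> X \<and> length hist = t \<and>
     (\<forall>(x, Q)\<in>set hist. x \<in> X \<and> l * (norm (x - saddle_x x r))\<^sup>2 \<le> 3 * Q) \<and>
     (\<exists>e\<le>B. foam_err z r S e \<and>
       saddle_val z r + 403 / 100 * e + 121 / 500 * B + 6 / 25 * sum_list (map snd hist) \<le> K))"

lemma tf_step_run:
  assumes r: "0 < r" "r \<le> l / 8" "alpha r = (1 / 2) ^ j" and inv: "outer_inv r K t s"
  shows "\<exists>s' k. tf_step orc X Y l r s = Some (s', k) \<and>
    k \<le> nat \<lceil>2 / (1 / 2) ^ j * ln (1 / (1 / 400 :: real))\<rceil> * (prox_budget + 2) \<and> outer_inv r K (Suc t) s'"
proof -
  obtain z \<omega> y \<omega>f yf B hist where s: "s = (z, (\<omega>, y, \<omega>f, yf), B, hist)" by (metis prod_cases4 prod.exhaust)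
  obtain e where z: "z \<in> X" and len: "length hist = t"
    and hist: "\<And>x Q. (x, Q) \<in> set hist \<Longrightarrow> x \<in> X \<and> l * (norm (x - saddle_x x r))\<^sup>2 \<le> 3 * Q"
    and eB: "e \<le> B" and err: "foam_err z r (\<omega>, y, \<omega>f, yf) e"
    and K: "saddle_val z r + 403 / 100 * e + 121 / 500 * B + 6 / 25 * sum_list (map snd hist) \<le> K"
    using inv unfolding outer_inv_def s by fastforce
  have e0: "0 \<le> e" by (rule foam_err_nonneg[OF r(1) err])
  define z' where "z' = proj X (- (1 / l) *\<^sub>R \<omega>f)"
  define d where "d = z' - z"
  define x where "x = l * (norm d)\<^sup>2"
  have x0: "0 \<le> x" using l by (simp add: x_def)
  have z'X: "z' \<in> X" unfolding z'_def using X by (intro proj_in) auto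
  have err': "foam_err z' r (\<omega> - (2 * l) *\<^sub>R d, y, \<omega>f - (2 * l) *\<^sub>R d, yf) (2 * e + 24 * x)"
    using foam_err_shift[OF r(1,2) err, of d] by (simp add: d_def x_def)
  obtain S' k where S': "foam orc X Y l z' r (\<omega> - (2 * l) *\<^sub>R d, y, \<omega>f - (2 * l) *\<^sub>R d, yf) (1 / 400) = Some (S', k)"
    "k \<le> nat \<lceil>2 / alpha r * ln (1 / (1 / 400 :: real))\<rceil> * (prox_budget + 2)"
    "foam_err z' r S' (1 / 400 * (2 * e + 24 * x))"
    using foam_run[OF r(1,2) err', of "1 / 400"] by auto
  define B' where "B' = 1 / 400 * (2 * B + 24 * x)"
  have step: "tf_step orc X Y l r s = Some ((z', S', B', hist @ [(z, x + B)]), k)"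
    unfolding tf_step_def s prod.case Let_def z'_def[symmetric] d_def[symmetric] S'(1)
    by (simp add: run_bind_def run_return_def x_def B'_def)
  note outer = outer_step[OF r(1) err z'_def, folded d_def, folded x_def]
  have "outer_inv r K (Suc t) (z', S', B', hist @ [(z, x + B)])"
    unfolding outer_inv_def prod.case
  proof (intro conjI z'X exI[of _ "1 / 400 * (2 * e + 24 * x)"] S'(3))
    show "\<forall>(x, Q)\<in>set (hist @ [(z, x + B)]). x \<in> X \<and> l * (norm (x - saddle_x x r))\<^sup>2 \<le> 3 * Q"
      using hist z outer(2) eB by auto
    show "1 / 400 * (2 * e + 24 * x) \<le> B'" using eB by (simp add: B'_def)
    have sum: "sum_list (map snd (hist @ [(z, x + B)])) = sum_list (map snd hist) + (x + B)" by simp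
    \<comment> \<open>Coefficientwise: 4 + 2*4.03/400 \<le> 4.03 for \<open>e\<close>, 0.24 +
      2*0.242/400 \<le> 0.242 for \<open>B\<close>, and 24*(4.03 + 0.242)/400 + 0.24 \<le> 1/2 for
      \<open>x\<close>.\<close>
    show "saddle_val z' r + 403 / 100 * (1 / 400 * (2 * e + 24 * x)) + 121 / 500 * B'
        + 6 / 25 * sum_list (map snd (hist @ [(z, x + B)])) \<le> K"
      using outer(1) K x0 e0 eB unfolding B'_def sum by argo
  qed (simp add: len)
  then show ?thesis using step S'(2) unfolding r(3) by blast
qed

lemma tracked_foam_run:
  assumes D: "0 < D" and \<Delta>: "0 < \<Delta>" and \<epsilon>: "0 < \<epsilon>"
  obtains z N r where "tracked_foam orc X Y l D \<Delta> \<epsilon> = Some (z, N)" "z \<in> X"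
    "0 < r" "l * (r * D\<^sup>2) \<le> \<epsilon>\<^sup>2 / 8" "l * norm (z - saddle_x z r) \<le> \<epsilon> / 4"
    "real N \<le> (7000000 * real (prox_budget + 2)) * (l * \<Delta> / \<epsilon>\<^sup>2 + 1) * max 1 (l * D / \<epsilon>)"
proof -
  define r\<epsilon> where "r\<epsilon> = min (l / 8) (\<epsilon>\<^sup>2 / (8 * l * D\<^sup>2))"
  define J where "J = (LEAST j. ry_level l j \<le> r\<epsilon>)"
  define r where "r = ry_level l J"
  define T where "T = nat \<lceil>4000 * (l * \<Delta> / \<epsilon>\<^sup>2 + 1)\<rceil>"
  define W where "W = l * \<Delta> / \<epsilon>\<^sup>2 + 1"
  define M where "M = real (prox_budget + 2)"
  have r\<epsilon>: "0 < r\<epsilon>" using l D \<epsilon> by (auto simp: r\<epsilon>_def)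
  have W: "1 \<le> W" using l \<Delta> by (simp add: W_def)
  have r: "0 < r" "r \<le> l / 8" "alpha r = (1 / 2) ^ J" using ry_level[of J] by (auto simp: r_def)
  have "\<exists>j. ry_level l j \<le> r\<epsilon>"
  proof -
    obtain j where "(1 / 4 :: real) ^ j < r\<epsilon> / (l / 8)"
      using real_arch_pow_inv[of "r\<epsilon> / (l / 8)" "1 / 4"] r\<epsilon> l by auto
    then show ?thesis using l by (intro exI[of _ j]) (simp add: ry_level_def field_simps)
  qed
  then have rle: "r \<le> r\<epsilon>" unfolding r_def J_def by (rule LeastI_ex)
  have "r \<le> \<epsilon>\<^sup>2 / (8 * l * D\<^sup>2)" using rle by (simp add: r\<epsilon>_def)
  then have rD: "l * (r * D\<^sup>2) \<le> \<epsilon>\<^sup>2 / 8" using l D by (simp add: field_simps)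
  \<comment> \<open>Minimality of \<open>J\<close> puts the preceding level above
    \<open>r\<epsilon>\<close>. As no level exceeds l/8, the other term of the minimum is the active
    one, and a square root gives the bound.\<close>
  have J: "2 ^ J \<le> 2 * max 1 (l * D / \<epsilon>)"
  proof (cases J)
    case (Suc j)
    have "r\<epsilon> < ry_level l j" using not_less_Least[of j "\<lambda>j. ry_level l j \<le> r\<epsilon>"] Suc by (simp add: J_def)
    then have "\<epsilon>\<^sup>2 / (8 * l * D\<^sup>2) < (1 / 4) ^ j * (l / 8)"
      using ry_level(2)[of j] by (auto simp: r\<epsilon>_def ry_level_def min_def split: if_splits)
    then have "4 ^ j * \<epsilon>\<^sup>2 < (l * D)\<^sup>2"
      using l D by (simp add: field_simps power_one_over power2_eq_square)
    also have "4 ^ j * \<epsilon>\<^sup>2 = (2 ^ j * \<epsilon>)\<^sup>2"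
      by (simp add: power_mult_distrib power2_eq_square flip: power_mult_distrib)
    finally have "2 ^ j * \<epsilon> < l * D" by (rule power2_less_imp_less) (use l D in auto)
    then have "2 ^ j \<le> l * D / \<epsilon>" using \<epsilon> by (simp add: field_simps)
    then show ?thesis using Suc by simp
  qed simp
  obtain S0 k0 where init: "tf_init orc X Y l J = Some (S0, k0)" "real k0 \<le> 32 * 2 ^ J * M"
    "foam_err 0 r S0 (\<Delta> + 2 * (r * D\<^sup>2))"
    using tf_init_run[of J] unfolding r_def M_def by blast
  define B0 where "B0 = 15 * (\<Delta> + r * D\<^sup>2)"
  have rD0: "0 \<le> r * D\<^sup>2" using r by simp
  define K where "K = saddle_val 0 r + 403 / 100 * (\<Delta> + 2 * (r * D\<^sup>2)) + 121 / 500 * B0"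
  have "outer_inv r K 0 (0, S0, B0, [])"
    unfolding outer_inv_def prod.case using init(3) X \<Delta> rD0
    by (auto simp: K_def B0_def intro!: exI[of _ "\<Delta> + 2 * (r * D\<^sup>2)"])
  then have "\<exists>s k. run_iter T (tf_step orc X Y l r) (0, S0, B0, []) = Some (s, k) \<and>
      k \<le> T * (nat \<lceil>2 / (1 / 2) ^ J * ln (1 / (1 / 400 :: real))\<rceil> * (prox_budget + 2)) \<and> outer_inv r K (0 + T) s"
    using tf_step_run[OF r] by (intro run_iter_invariant[where P = "outer_inv r K"]) auto
  then obtain z S B hist k1 where iter:
    "run_iter T (tf_step orc X Y l r) (0, S0, B0, []) = Some ((z, S, B, hist), k1)"
    "k1 \<le> T * (nat \<lceil>2 / (1 / 2) ^ J * ln (1 / (1 / 400 :: real))\<rceil> * (prox_budget + 2))"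
    "outer_inv r K T (z, S, B, hist)"
    by (metis add_0 prod_cases4)
  from iter(3) obtain e where z: "z \<in> X" and len: "length hist = T"
    and hist: "\<And>x Q. (x, Q) \<in> set hist \<Longrightarrow> x \<in> X \<and> l * (norm (x - saddle_x x r))\<^sup>2 \<le> 3 * Q"
    and eB: "e \<le> B" and err: "foam_err z r S e"
    and K: "saddle_val z r + 403 / 100 * e + 121 / 500 * B + 6 / 25 * sum_list (map snd hist) \<le> K"
    unfolding outer_inv_def by fastforce
  define Q where "Q = (\<lambda>t. snd (hist ! t))"
  define t where "t = (LEAST t. t < T \<and> (\<forall>t'<T. Q t \<le> Q t'))"
  have T: "4000 * W \<le> T" "T \<le> 4001 * W"
    using W unfolding T_def W_def[symmetric] by linarith+
  have "T > 0" using T W by (cases T) auto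
  then have "\<exists>t. t < T \<and> (\<forall>t'<T. Q t \<le> Q t')"
    using ex_min_if_finite[of "Q ` {..<T}"] by (auto simp: not_less)
  from LeastI_ex[OF this] have t: "t < T" "\<And>t'. t' < T \<Longrightarrow> Q t \<le> Q t'"
    unfolding t_def by auto
  have "tracked_foam orc X Y l D \<Delta> \<epsilon> = Some (fst (hist ! t), k0 + k1)"
    unfolding tracked_foam_def Let_def r\<epsilon>_def[symmetric] J_def[symmetric] r_def[symmetric]
      T_def[symmetric] B0_def[symmetric] init(1)
    by (simp add: run_bind_def run_return_def iter(1) t_def Q_def)
  moreover have in_hist: "(fst (hist ! t), Q t) \<in> set hist"
    using t len by (simp add: Q_def)
  have "fst (hist ! t) \<in> X" using hist[OF in_hist] by simp
  moreover have "l * norm (fst (hist ! t) - saddle_x (fst (hist ! t)) r) \<le> \<epsilon> / 4"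
  proof -
    have "T * Q t \<le> (\<Sum>t'<T. Q t')"
      using sum_mono[of "{..<T}" "\<lambda>_. Q t" Q] t by simp
    also have "\<dots> = sum_list (map snd hist)"
      by (simp add: sum_list_sum_nth len Q_def atLeast0LessThan)
    finally have TQ: "T * Q t \<le> sum_list (map snd hist)" .
    have "\<Phi> 0 - \<Delta> - r / 2 * D\<^sup>2 \<le> saddle_val z r"
    proof -
      have "0 \<le> l * (norm (saddle_x z r - z))\<^sup>2" using l by simp
      then show ?thesis using saddle_val_lower[OF r(1), of z] gap[OF saddle_in(1)[OF r(1)], of z] by linarith
    qed
    moreover have "saddle_val 0 r \<le> \<Phi> 0"
    proof -
      have "0 \<le> l / 2 * (norm (0 - saddle_x 0 r))\<^sup>2" using l by simp
      then show ?thesis using saddle_val_upper[OF r(1) X(3)] by linarith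
    qed
    moreover have "0 \<le> e" by (rule foam_err_nonneg[OF r(1) err])
    \<comment> \<open>Here 6/25 of the sum is at most 8.66 \<Delta> + 12.19 r D^2, and 51 * 6/25 =
      12.24.\<close>
    ultimately have "sum_list (map snd hist) \<le> 51 * (\<Delta> + r * D\<^sup>2)"
      using K eB \<Delta> rD0 unfolding K_def B0_def by argo
    with TQ have "l * (T * Q t) \<le> l * (51 * (\<Delta> + r * D\<^sup>2))" using l by (intro mult_left_mono) auto
    also have "\<dots> = 51 * (l * \<Delta> + l * (r * D\<^sup>2))" by (simp add: algebra_simps)
    also have "\<dots> \<le> 51 * (l * \<Delta> + \<epsilon>\<^sup>2)" using rD zero_le_power2[of \<epsilon>] by argo
    also have "\<dots> = 51 * (\<epsilon>\<^sup>2 * W)" using \<epsilon> by (simp add: W_def field_simps)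
    finally have *: "T * (l * Q t) \<le> 51 * (\<epsilon>\<^sup>2 * W)" by (simp add: algebra_simps)
    have Q0: "0 \<le> Q t"
    proof -
      have "0 \<le> l * (norm (fst (hist ! t) - saddle_x (fst (hist ! t)) r))\<^sup>2" using l by simp
      then show ?thesis using hist[OF in_hist] by linarith
    qed
    have "(4000 * W) * (l * Q t) \<le> T * (l * Q t)" using T l Q0 by (intro mult_right_mono) auto
    with * have "W * (4000 * (l * Q t)) \<le> W * (51 * \<epsilon>\<^sup>2)" by (simp add: algebra_simps)
    then have lQ: "4000 * (l * Q t) \<le> 51 * \<epsilon>\<^sup>2" using W by (simp add: mult_le_cancel_left)
    have "(l * norm (fst (hist ! t) - saddle_x (fst (hist ! t)) r))\<^sup>2
        = l * (l * (norm (fst (hist ! t) - saddle_x (fst (hist ! t)) r))\<^sup>2)"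
      by (simp add: power2_eq_square)
    also have "\<dots> \<le> l * (3 * Q t)" using hist[OF in_hist] l by (intro mult_left_mono) auto
    \<comment> \<open>3 * 51/4000 is below 1/16; this is what the factor 4000 in the number of outer
      iterations provides.\<close>
    also have "\<dots> \<le> \<epsilon>\<^sup>2 / 16" using lQ zero_le_power2[of \<epsilon>] by linarith
    also have "\<dots> = (\<epsilon> / 4)\<^sup>2" by (simp add: power_divide)
    finally show ?thesis by (rule power2_le_imp_le) (use \<epsilon> in auto)
  qed
  moreover have "real (k0 + k1) \<le> (7000000 * M) * W * max 1 (l * D / \<epsilon>)"
  proof -
    have M: "0 \<le> M" by (simp add: M_def)
    define steps where "steps = nat \<lceil>2 / (1 / 2) ^ J * ln (1 / (1 / 400 :: real))\<rceil>"
    have steps: "real steps \<le> 2 ^ J * (2 / (1 / 400))" unfolding steps_def by (rule foam_calls) simp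
    have "real k1 \<le> T * (real steps * M)"
      using iter(2) unfolding steps_def[symmetric] M_def of_nat_mult[symmetric] of_nat_le_iff .
    also have "\<dots> \<le> (4001 * W) * ((2 ^ J * (2 / (1 / 400))) * M)"
      using T W M steps by (intro mult_mono mult_right_mono) auto
    \<comment> \<open>4001 * 800 = 3200800; the bound on \<open>2 ^ J\<close> later doubles the
      rounded constant.\<close>
    finally have "real (k0 + k1) \<le> 32 * (2 ^ J * M) + 3200800 * (W * (2 ^ J * M))"
      using init(2) by (simp add: algebra_simps)
    also have "32 * (2 ^ J * M) \<le> 32 * (W * (2 ^ J * M))"
      using mult_right_mono[OF W, of "2 ^ J * M"] M by simp
    also have "32 * (W * (2 ^ J * M)) + 3200800 * (W * (2 ^ J * M)) \<le> 3500000 * (W * (2 ^ J * M))"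
      using W M by simp
    also have "\<dots> \<le> 3500000 * (W * (2 * max 1 (l * D / \<epsilon>) * M))"
      using J W M by (intro mult_left_mono mult_right_mono) auto
    finally show ?thesis by (simp add: algebra_simps)
  qed
  ultimately show thesis using that r(1) rD unfolding M_def W_def by blast
qed

end

section \<open>The Moreau envelope\<close>

context smooth_saddle
begin

lemma primal_fun_eq: "x \<in> X \<Longrightarrow> primal_fun X Y f x = ereal (\<Phi> x)"
proof -
  assume x: "x \<in> X"
  have "(SUP y\<in>Y. ereal (f (x, y))) = ereal (\<Phi> x)"
  proof (rule antisym)
    show "(SUP y\<in>Y. ereal (f (x, y))) \<le> ereal (\<Phi> x)"
      using f_le_\<Phi>[OF x] by (intro SUP_least) simp
    show "ereal (\<Phi> x) \<le> (SUP y\<in>Y. ereal (f (x, y)))"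
    proof (rule ereal_le_epsilon2)
      fix e :: real assume "0 < e"
      then have "\<Phi> x - e < (SUP y\<in>Y. f (x, y))" unfolding \<Phi>_def by simp
      then obtain y where y: "y \<in> Y" "\<Phi> x - e < f (x, y)"
        using less_cSUP_iff[OF _ bdd_above_f[OF x]] Y(3) by blast
      have "ereal (\<Phi> x) \<le> ereal (f (x, y)) + ereal e" using y(2) by simp
      also have "\<dots> \<le> (SUP y\<in>Y. ereal (f (x, y))) + ereal e"
        using y(1) by (intro add_right_mono SUP_upper)
      finally show "ereal (\<Phi> x) \<le> (SUP y\<in>Y. ereal (f (x, y))) + ereal e" .
    qed
  qed
  then show ?thesis using x by (simp add: primal_fun_def)
qed

end

context smooth_saddle_gap
begin

definition prox_obj :: "'a \<Rightarrow> 'a \<Rightarrow> real" where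
  "prox_obj z x = \<Phi> x + l * (norm (x - z))\<^sup>2"

text \<open>Expanding each f(., y) at the midpoint loses at most l/8 |x - x'|^2, uniformly in y,
  hence also after the supremum. The proximal term gains l/4, so l/8 remains.\<close>

lemma prox_obj_midpoint:
  assumes x: "x \<in> X" and x': "x' \<in> X"
  defines "w \<equiv> (1 / 2) *\<^sub>R x + (1 / 2) *\<^sub>R x'"
  shows "w \<in> X" "prox_obj z w \<le> (prox_obj z x + prox_obj z x') / 2 - l / 8 * (norm (x - x'))\<^sup>2"
proof -
  show w: "w \<in> X" unfolding w_def using X(2) x x' by (intro convexD) auto
  have half: "v = (1 / 2) *\<^sub>R v + (1 / 2) *\<^sub>R v" for v :: 'a
    by (metis field_sum_of_halves scaleR_add_left scaleR_one)
  have d: "x - w = (1 / 2) *\<^sub>R (x - x')" "x' - w = - (1 / 2) *\<^sub>R (x - x')"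
    by (subst half[of x], simp add: w_def scaleR_diff_right)
      (subst half[of x'], simp add: w_def scaleR_diff_right)
  have "\<Phi> w \<le> (\<Phi> x + \<Phi> x') / 2 + l / 8 * (norm (x - x'))\<^sup>2"
  proof (rule \<Phi>_least)
    fix y assume y: "y \<in> Y"
    define G where "G = gx w y \<bullet> ((1 / 2) *\<^sub>R (x - x'))"
    have "f (w, y) + G - l / 2 * ((1 / 4) * (norm (x - x'))\<^sup>2) \<le> f (x, y)"
      using abs_le_D2[OF descent_x[OF w x y]] unfolding d G_def norm_scaleR power_mult_distrib
      by (simp add: power2_eq_square)
    moreover have "f (w, y) - G - l / 2 * ((1 / 4) * (norm (x - x'))\<^sup>2) \<le> f (x', y)"
      using abs_le_D2[OF descent_x[OF w x' y]] unfolding d G_def norm_scaleR power_mult_distrib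
      by (simp add: power2_eq_square)
    ultimately show "f (w, y) \<le> (\<Phi> x + \<Phi> x') / 2 + l / 8 * (norm (x - x'))\<^sup>2"
      using f_le_\<Phi>[OF x y] f_le_\<Phi>[OF x' y] by argo
  qed
  moreover have "l * (norm (w - z))\<^sup>2
      = (l * (norm (x - z))\<^sup>2 + l * (norm (x' - z))\<^sup>2) / 2 - l / 4 * (norm (x - x'))\<^sup>2"
    unfolding power2_norm_eq_inner w_def by (simp add: inner_simps inner_commute field_simps)
  ultimately show "prox_obj z w \<le> (prox_obj z x + prox_obj z x') / 2 - l / 8 * (norm (x - x'))\<^sup>2"
    unfolding prox_obj_def by argo
qed

lemma prox_point_exists: "\<exists>x\<in>X. \<forall>x'\<in>X. prox_obj z x \<le> prox_obj z x'"
proof (rule strongly_midconvex_has_minimizer[OF X(1)])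
  show "X \<noteq> {}" using X by auto
  show "0 < l / 8" using l by simp
  show "\<Phi> 0 - \<Delta> \<le> prox_obj z x" if "x \<in> X" for x
  proof -
    have "0 \<le> l * (norm (x - z))\<^sup>2" using l by simp
    then show ?thesis using gap[OF that] by (simp add: prox_obj_def)
  qed
  show "\<exists>w\<in>X. prox_obj z w \<le> (prox_obj z x + prox_obj z x') / 2 - l / 8 * (norm (x - x'))\<^sup>2"
    if "x \<in> X" "x' \<in> X" for x x'
    using prox_obj_midpoint[OF that] by blast
next
  fix s x e
  assume s: "\<And>n. s n \<in> X" "x \<in> X" "s \<longlonglongrightarrow> x" and lim: "(\<lambda>n. prox_obj z (s n)) \<longlonglongrightarrow> e"
  \<comment> \<open>Lower semicontinuity: for each fixed y the quadratic minorant of f(., y) at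
    \<open>x\<close> passes to the limit, and the supremum over y is taken afterwards.\<close>
  have "\<Phi> x \<le> e - l * (norm (x - z))\<^sup>2"
  proof (rule \<Phi>_least)
    fix y assume y: "y \<in> Y"
    have "(\<lambda>n. f (x, y) + gx x y \<bullet> (s n - x) - l / 2 * (norm (s n - x))\<^sup>2)
        \<longlonglongrightarrow> f (x, y) + gx x y \<bullet> (x - x) - l / 2 * (norm (x - x))\<^sup>2"
      by (intro tendsto_intros s(3))
    moreover have "(\<lambda>n. prox_obj z (s n) - l * (norm (s n - z))\<^sup>2) \<longlonglongrightarrow> e - l * (norm (x - z))\<^sup>2"
      by (intro tendsto_intros s(3) lim)
    moreover have "f (x, y) + gx x y \<bullet> (s n - x) - l / 2 * (norm (s n - x))\<^sup>2
        \<le> prox_obj z (s n) - l * (norm (s n - z))\<^sup>2" for n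
      using abs_le_D2[OF descent_x[OF s(2) s(1) y, of n]] f_le_\<Phi>[OF s(1) y, of n]
      by (simp add: prox_obj_def)
    ultimately have "f (x, y) + gx x y \<bullet> (x - x) - l / 2 * (norm (x - x))\<^sup>2 \<le> e - l * (norm (x - z))\<^sup>2"
      using LIMSEQ_le by blast
    then show "f (x, y) \<le> e - l * (norm (x - z))\<^sup>2" by simp
  qed
  then show "prox_obj z x \<le> e" by (simp add: prox_obj_def)
qed

definition prox_point :: "'a \<Rightarrow> 'a" where
  "prox_point z = (SOME x. x \<in> X \<and> (\<forall>x'\<in>X. prox_obj z x \<le> prox_obj z x'))"

lemma prox_point: "prox_point z \<in> X" "x \<in> X \<Longrightarrow> prox_obj z (prox_point z) \<le> prox_obj z x"
proof -
  have "prox_point z \<in> X \<and> (\<forall>x'\<in>X. prox_obj z (prox_point z) \<le> prox_obj z x')"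
    using prox_point_exists[of z] unfolding prox_point_def Bex_def by (rule someI_ex)
  then show "prox_point z \<in> X" "x \<in> X \<Longrightarrow> prox_obj z (prox_point z) \<le> prox_obj z x" by blast+
qed

text \<open>Comparison with the midpoint yields half of the growth that strong convexity would give,
  which suffices below.\<close>

lemma prox_obj_growth:
  assumes "x \<in> X"
  shows "prox_obj z (prox_point z) + l / 4 * (norm (x - prox_point z))\<^sup>2 \<le> prox_obj z x"
  using prox_point(2)[OF prox_obj_midpoint(1)[OF assms prox_point(1)], of z z]
    prox_obj_midpoint(2)[OF assms prox_point(1), of z z] by argo

text \<open>Regularising in y makes the saddle point's x a minimiser of the proximal objective up to
  r D^2/4; the growth l/2 of the saddle objective turns this value error into a distance.\<close>

lemma saddle_near_prox_point:
  assumes r: "r > 0"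
  shows "l * (norm (saddle_x z r - prox_point z))\<^sup>2 \<le> r * D\<^sup>2 / 2"
proof -
  let ?x = "saddle_x z r" and ?y = "saddle_y z r" and ?p = "prox_point z"
  have "\<Phi> ?x \<le> f (?x, ?y) + r * D\<^sup>2 / 4"
  proof (rule \<Phi>_least)
    fix y assume y: "y \<in> Y"
    \<comment> \<open>Dropping the nonnegative squares would give r D^2/2 and with it twice the
      squared distance that the budget \<epsilon>/4 allows. Completing the square halves the
      error.\<close>
    have "0 \<le> r * (norm (y - 2 *\<^sub>R ?y))\<^sup>2 / 4" using r by simp
    also have "\<dots> = r / 2 * (norm (y - ?y))\<^sup>2 - r / 2 * (norm y)\<^sup>2 + r / 2 * (norm ?y)\<^sup>2 + r * (norm y)\<^sup>2 / 4"
      unfolding power2_norm_eq_inner by (simp add: inner_simps inner_commute field_simps)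
    finally have "0 \<le> r / 2 * (norm (y - ?y))\<^sup>2 - r / 2 * (norm y)\<^sup>2 + r / 2 * (norm ?y)\<^sup>2 + r * (norm y)\<^sup>2 / 4" .
    moreover have "r * (norm y)\<^sup>2 / 4 \<le> r * D\<^sup>2 / 4"
      using r norm2_Y[OF y] by simp
    ultimately show "f (?x, y) \<le> f (?x, ?y) + r * D\<^sup>2 / 4"
      using saddle_max_y[OF r y, of z] by argo
  qed
  moreover have "prox_obj z ?p \<le> prox_obj z ?x" by (rule prox_point(2)[OF saddle_in(1)[OF r]])
  moreover have "f (?p, ?y) \<le> \<Phi> ?p" by (rule f_le_\<Phi>[OF prox_point(1) saddle_in(2)[OF r]])
  ultimately show ?thesis
    using saddle_min_x[OF r prox_point(1), of z z] unfolding prox_obj_def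
    by (simp add: norm_minus_commute)
qed

text \<open>Upper bound: the old proximal point competes at the new centre. Lower bound: growth
  around the old proximal point absorbs its displacement. Hence the envelope has gradient 2 l (z -
  \<open>prox_point z\<close>).\<close>

lemma prox_value_quadratic_bound:
  "\<bar>prox_obj z' (prox_point z') - prox_obj z (prox_point z) - (2 * l) *\<^sub>R (z - prox_point z) \<bullet> (z' - z)\<bar>
    \<le> 4 * l * (norm (z' - z))\<^sup>2"
proof -
  define h where "h = z' - z"
  have shift: "prox_obj z' x = prox_obj z x + 2 * l * ((z - x) \<bullet> h) + l * (norm h)\<^sup>2" for x
    unfolding prox_obj_def h_def power2_norm_eq_inner
    by (simp add: inner_simps inner_commute algebra_simps)
  let ?p = "prox_point z" and ?p' = "prox_point z'"
  have "prox_obj z' ?p' \<le> prox_obj z ?p + 2 * l * ((z - ?p) \<bullet> h) + l * (norm h)\<^sup>2"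
    using prox_point(2)[OF prox_point(1), of z' z] by (simp add: shift)
  moreover have "prox_obj z ?p + 2 * l * ((z - ?p) \<bullet> h) - 4 * (l * (norm h)\<^sup>2) \<le> prox_obj z' ?p'"
  proof -
    \<comment> \<open>The shift by 4 h balances the growth l/4 against the cross term.\<close>
    have "0 \<le> l / 4 * (norm ((?p' - ?p) - 4 *\<^sub>R h))\<^sup>2" using l by simp
    also have "\<dots> = l / 4 * (norm (?p' - ?p))\<^sup>2 - 2 * l * ((?p' - ?p) \<bullet> h) + 4 * (l * (norm h)\<^sup>2)"
      unfolding power2_norm_eq_inner by (simp add: inner_simps inner_commute field_simps)
    finally have "2 * l * ((?p' - ?p) \<bullet> h) - 4 * (l * (norm h)\<^sup>2) \<le> l / 4 * (norm (?p' - ?p))\<^sup>2" by simp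
    moreover have "0 \<le> l * (norm h)\<^sup>2" using l by simp
    moreover have "2 * l * ((z - ?p') \<bullet> h) = 2 * l * ((z - ?p) \<bullet> h) - 2 * l * ((?p' - ?p) \<bullet> h)"
      by (simp add: inner_diff_left algebra_simps)
    ultimately show ?thesis
      using prox_obj_growth[OF prox_point(1), of z z'] unfolding shift[of ?p'] by linarith
  qed
  moreover have "0 \<le> l * (norm h)\<^sup>2" using l by simp
  ultimately show ?thesis unfolding h_def[symmetric] by (simp add: abs_le_iff)
qed

context
  fixes E :: "'a set"
  assumes E: "X \<subseteq> E"
begin

lemma moreau_env_eq: "moreau_env E l (primal_fun X Y f) z = prox_obj z (prox_point z)"
proof -
  have X_eq: "primal_fun X Y f x + ereal (l * (norm (z - x))\<^sup>2) = ereal (prox_obj z x)" if "x \<in> X" for x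
    using primal_fun_eq[OF that] by (simp add: prox_obj_def norm_minus_commute)
  have "(INF x\<in>E. primal_fun X Y f x + ereal (l * (norm (z - x))\<^sup>2)) = ereal (prox_obj z (prox_point z))"
  proof (rule antisym)
    show "(INF x\<in>E. primal_fun X Y f x + ereal (l * (norm (z - x))\<^sup>2)) \<le> ereal (prox_obj z (prox_point z))"
      using INF_lower[OF subsetD[OF E prox_point(1)], where f = "\<lambda>x. primal_fun X Y f x + ereal (l * (norm (z - x))\<^sup>2)"]
      unfolding X_eq[OF prox_point(1)] .
    show "ereal (prox_obj z (prox_point z)) \<le> (INF x\<in>E. primal_fun X Y f x + ereal (l * (norm (z - x))\<^sup>2))"
    proof (rule INF_greatest)
      fix x assume "x \<in> E"
      show "ereal (prox_obj z (prox_point z)) \<le> primal_fun X Y f x + ereal (l * (norm (z - x))\<^sup>2)"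
      proof (cases "x \<in> X")
        case True
        then show ?thesis using prox_point(2) X_eq by simp
      next
        case False
        then show ?thesis by (simp add: primal_fun_def)
      qed
    qed
  qed
  then show ?thesis by (simp add: moreau_env_def)
qed

lemma moreau_env_has_gradient:
  "(moreau_env E l (primal_fun X Y f) has_derivative (\<lambda>h. (2 * l) *\<^sub>R (z - prox_point z) \<bullet> h)) (at z within E)"
  unfolding has_derivative_within_alt
proof (intro conjI allI impI)
  fix e :: real assume e: "0 < e"
  show "\<exists>d>0. \<forall>y\<in>E. norm (y - z) < d \<longrightarrow> norm (moreau_env E l (primal_fun X Y f) y
      - moreau_env E l (primal_fun X Y f) z - (2 * l) *\<^sub>R (z - prox_point z) \<bullet> (y - z)) \<le> e * norm (y - z)"
  proof (intro exI[of _ "e / (4 * l)"] conjI ballI impI)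
    fix y assume y: "norm (y - z) < e / (4 * l)"
    have "4 * l * norm (y - z) * norm (y - z) \<le> e * norm (y - z)"
      using y l by (intro mult_right_mono) (auto simp: field_simps)
    then show "norm (moreau_env E l (primal_fun X Y f) y - moreau_env E l (primal_fun X Y f) z
        - (2 * l) *\<^sub>R (z - prox_point z) \<bullet> (y - z)) \<le> e * norm (y - z)"
      using prox_value_quadratic_bound[of y z] unfolding moreau_env_eq
      by (simp add: power2_eq_square)
  qed (use e l in simp)
qed (rule bounded_linear_inner_right)

lemma eps_OS_if_near_saddle:
  assumes sub: "subspace E" and \<epsilon>: "0 < \<epsilon>" and z: "z \<in> X" and r: "0 < r"
    and rD: "l * (r * D\<^sup>2) \<le> \<epsilon>\<^sup>2 / 8" and near: "l * norm (z - saddle_x z r) \<le> \<epsilon> / 4"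
  shows "eps_OS E l X Y f \<epsilon> z"
proof -
  have "l * norm (saddle_x z r - prox_point z) \<le> \<epsilon> / 4"
  proof (rule power2_le_imp_le)
    have "(l * norm (saddle_x z r - prox_point z))\<^sup>2 = l * (l * (norm (saddle_x z r - prox_point z))\<^sup>2)"
      by (simp add: power2_eq_square)
    also have "\<dots> \<le> l * (r * D\<^sup>2 / 2)" using saddle_near_prox_point[OF r] l by (intro mult_left_mono) auto
    also have "\<dots> \<le> (\<epsilon> / 4)\<^sup>2" using rD by (simp add: power_divide)
    finally show "(l * norm (saddle_x z r - prox_point z))\<^sup>2 \<le> (\<epsilon> / 4)\<^sup>2" .
  qed (use \<epsilon> in simp)
  moreover have "l * norm (z - prox_point z) \<le> l * (norm (z - saddle_x z r) + norm (saddle_x z r - prox_point z))"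
    using l norm_triangle_ineq[of "z - saddle_x z r" "saddle_x z r - prox_point z"]
    by (intro mult_left_mono) auto
  ultimately have "norm ((2 * l) *\<^sub>R (z - prox_point z)) \<le> \<epsilon>"
    using near l by (simp add: distrib_left)
  moreover have "(2 * l) *\<^sub>R (z - prox_point z) \<in> E"
    using sub E z prox_point(1)[of z] by (intro subspace_scale subspace_diff) auto
  ultimately show ?thesis unfolding eps_OS_def using z moreau_env_has_gradient by blast
qed

end

end

section \<open>Completeness of the coordinate subspaces and the final assembly\<close>

lemma abs_coord_le_norm: "\<bar>coord v i\<bar> \<le> norm v"
proof (cases "coord v i = 0")
  case False
  then have "(coord v i)\<^sup>2 \<le> (\<Sum>j | coord v j \<noteq> 0. coord v j * coord v j)"
    unfolding power2_eq_square by (intro member_le_sum[of i _ "\<lambda>j. coord v j * coord v j"]) auto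
  then show ?thesis unfolding norm_fsvec_def inner_fsvec_def by (metis real_sqrt_abs real_sqrt_le_mono)
qed simp

lemma subspace_Rn: "subspace (Rn n)"
  by (auto simp: subspace_def Rn_def)

text \<open>Within \<open>Rn n\<close> the norm is a sum over the same \<open>n\<close> coordinates
  for all vectors, so coordinatewise limits suffice although the whole space is incomplete.\<close>

lemma complete_Rn: "complete (Rn n)"
  unfolding complete_def
proof (intro allI impI)
  fix s assume s: "(\<forall>k. s k \<in> Rn n) \<and> Cauchy s"
  have "Cauchy (\<lambda>k. coord (s k) i)" for i
  proof (rule metric_CauchyI)
    fix e :: real assume "0 < e"
    then obtain N where "\<forall>j\<ge>N. \<forall>k\<ge>N. dist (s j) (s k) < e" using s by (meson metric_CauchyD)
    moreover have "dist (coord (s j) i) (coord (s k) i) \<le> dist (s j) (s k)" for j k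
      using abs_coord_le_norm[of "s j - s k" i] by (simp add: dist_norm)
    ultimately show "\<exists>N. \<forall>j\<ge>N. \<forall>k\<ge>N. dist (coord (s j) i) (coord (s k) i) < e"
      by (meson le_less_trans)
  qed
  then have "\<forall>i. \<exists>a. (\<lambda>k. coord (s k) i) \<longlonglongrightarrow> a" by (simp add: Cauchy_convergent_iff convergent_def)
  then obtain a where a: "\<And>i. (\<lambda>k. coord (s k) i) \<longlonglongrightarrow> a i" by metis
  \<comment> \<open>The cut-off at \<open>n\<close> makes the support visibly finite, as
    \<open>Abs_fsvec\<close> requires.\<close>
  define v where "v = Abs_fsvec (\<lambda>i. if i < n then a i else 0)"
  have "finite {i. (if i < n then a i else 0) \<noteq> 0}" by (rule finite_subset[of _ "{..<n}"]) auto
  then have v: "coord v = (\<lambda>i. if i < n then a i else 0)" by (simp add: v_def Abs_fsvec_inverse)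
  have sn: "coord (s k) i = 0" if "i \<ge> n" for k i using s that by (simp add: Rn_def)
  have "norm (s k - v) = sqrt (\<Sum>i<n. (coord (s k) i - a i) * (coord (s k) i - a i))" for k
  proof -
    have "{i. coord (s k - v) i \<noteq> 0} \<subseteq> {..<n}" by (rule subsetI, rule ccontr) (simp add: v sn)
    then show ?thesis unfolding norm_fsvec_def by (subst inner_fsvec_superset[of "{..<n}"]) (auto simp: v)
  qed
  moreover have "(\<lambda>k. sqrt (\<Sum>i<n. (coord (s k) i - a i) * (coord (s k) i - a i)))
      \<longlonglongrightarrow> sqrt (\<Sum>i<n. (a i - a i) * (a i - a i))"
    by (intro tendsto_intros a)
  ultimately have "(\<lambda>k. norm (s k - v)) \<longlonglongrightarrow> 0" by simp
  then have "s \<longlonglongrightarrow> v" using Lim_null[of s v] tendsto_norm_zero_iff by blast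
  moreover have "v \<in> Rn n" by (simp add: Rn_def v)
  ultimately show "\<exists>v\<in>Rn n. s \<longlonglongrightarrow> v" by blast
qed

lemma saddle_class_smooth_saddle_gap:
  assumes l: "l > 0" and cl: "saddle_class (Rn m) (Rn n) l D \<Delta> X Y f g"
  shows "smooth_saddle_gap X Y f g l D \<Delta>"
proof -
  have XY: "X \<subseteq> Rn m" "closed X" "convex X" "0 \<in> X" "Y \<subseteq> Rn n" "closed Y" "convex Y" "0 \<in> Y"
    "bounded Y" "diameter Y \<le> D" "is_gradient_on (Rn m \<times> Rn n) (X \<times> Y) f g" "l-lipschitz_on (X \<times> Y) g"
    "\<forall>x\<in>X. concave_on Y (\<lambda>y. f (x, y))"
    and gap: "primal_fun X Y f 0 - (INF x\<in>X. primal_fun X Y f x) \<le> ereal \<Delta>"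
    using cl unfolding saddle_class_def by auto
  interpret smooth_saddle X Y f g l D
  proof
    show "complete X" "complete Y" using XY complete_Rn complete_closed_subset by blast+
    show "norm y \<le> D" if "y \<in> Y" for y
      using diameter_bounded_bound[OF XY(9,8) that] XY(10) by (simp add: dist_norm)
    show "(f has_derivative (\<lambda>h. g p \<bullet> h)) (at p within X \<times> Y)" if "p \<in> X \<times> Y" for p
      using XY(11) that unfolding is_gradient_on_def by blast
  qed (use l XY in auto)
  show ?thesis
  proof
    fix x assume x: "x \<in> X"
    have "ereal (\<Phi> 0) - ereal (\<Phi> x) \<le> primal_fun X Y f 0 - (INF x\<in>X. primal_fun X Y f x)"
      using primal_fun_eq[OF XY(4)] primal_fun_eq[OF x] INF_lower[OF x, of "primal_fun X Y f"]
      by (intro ereal_minus_mono) auto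
    from order_trans[OF this gap] show "\<Phi> 0 - \<Phi> x \<le> \<Delta>" by simp
  qed
qed

theorem theorem3p3:
  shows "\<exists>C::real. C > 0 \<and>
    (\<forall>(l::real) (D::real) (\<Delta>::real) (\<epsilon>::real) (m::nat) (n::nat) (X::fsvec set) (Y::fsvec set)
       (f :: fsvec \<times> fsvec \<Rightarrow> real) (g :: fsvec \<times> fsvec \<Rightarrow> fsvec \<times> fsvec).
       l > 0 \<longrightarrow> D > 0 \<longrightarrow> \<Delta> > 0 \<longrightarrow> \<epsilon> > 0 \<longrightarrow>
       saddle_class (Rn m) (Rn n) l D \<Delta> X Y f g \<longrightarrow>
       (\<exists>x N. tracked_foam (saddle_oracle X Y f g) X Y l D \<Delta> \<epsilon> = Some (x, N) \<and>
              eps_OS (Rn m) l X Y f \<epsilon> x \<and>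
              real N \<le> C * (l * \<Delta> / \<epsilon>\<^sup>2 + 1) * max 1 (l * D / \<epsilon>)))"
proof (intro exI[of _ "7000000 * real (prox_budget + 2)"] conjI allI impI)
  fix l D \<Delta> \<epsilon> :: real and m n :: nat and X Y :: "fsvec set"
    and f :: "fsvec \<times> fsvec \<Rightarrow> real" and g :: "fsvec \<times> fsvec \<Rightarrow> fsvec \<times> fsvec"
  assume pos: "l > 0" "D > 0" "\<Delta> > 0" "\<epsilon> > 0" and cl: "saddle_class (Rn m) (Rn n) l D \<Delta> X Y f g"
  interpret smooth_saddle_gap X Y f g l D \<Delta>
    using saddle_class_smooth_saddle_gap[OF pos(1) cl] .
  have XE: "X \<subseteq> Rn m" using cl by (simp add: saddle_class_def)
  obtain z N r where "tracked_foam (saddle_oracle X Y f g) X Y l D \<Delta> \<epsilon> = Some (z, N)" "z \<in> X"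
    "0 < r" "l * (r * D\<^sup>2) \<le> \<epsilon>\<^sup>2 / 8" "l * norm (z - saddle_x z r) \<le> \<epsilon> / 4"
    "real N \<le> (7000000 * real (prox_budget + 2)) * (l * \<Delta> / \<epsilon>\<^sup>2 + 1) * max 1 (l * D / \<epsilon>)"
    using tracked_foam_run[OF pos(2-4)] by blast
  then show "\<exists>x N. tracked_foam (saddle_oracle X Y f g) X Y l D \<Delta> \<epsilon> = Some (x, N) \<and>
      eps_OS (Rn m) l X Y f \<epsilon> x \<and>
      real N \<le> 7000000 * real (prox_budget + 2) * (l * \<Delta> / \<epsilon>\<^sup>2 + 1) * max 1 (l * D / \<epsilon>)"
    using eps_OS_if_near_saddle[OF XE subspace_Rn pos(4)] by blast
qed simp

end
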